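(* Let $S$ be a finite set of points in $\mathbb{R}^3$. Then the diameter graph on $S$ can be embedded (without edge crossings) in the real projective plane in such a way that every odd cycle of the graph is embedded as a noncontractible closed curve.
   Context: For a finite set $S$ of points in $\mathbb{R}^d$ (with the Euclidean norm), the diameter $D$ of $S$ is the maximum distance between two points of $S$. The diameter graph on $S$ is the graph with vertex set $S$ in which two distinct points are joined by an edge exactly when they are at distance $D$. An odd cycle is a cycle of odd length in the graph. *)

theory Defs
  imports "HOL-Analysis.Analysis" "Graph_Theory.Pair_Digraph"
begin

section \<open>The real projective plane\<close>

definition antipodal_rel :: "real ^ 3 \<Rightarrow> real ^ 3 \<Rightarrow> bool" where
  "antipodal_rel x y \<longleftrightarrow> x \<in> sphere 0 1 \<and> y \<in> sphere 0 1 \<and> (y = x \<or> y = - x)"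

quotient_type rp2 = "real ^ 3" / partial: antipodal_rel
proof (rule part_equivpI)
  have "antipodal_rel (axis 1 1) (axis 1 1)"
    by (simp add: antipodal_rel_def)
  then show "\<exists>x. antipodal_rel x x" ..
qed (auto simp: symp_def transp_def antipodal_rel_def)

text \<open>Each point of \<^typ>\<open>rp2\<close> is \<^term>\<open>abs_rp2 x\<close> for some unit vector \<open>x\<close>;
  the value of \<^const>\<open>abs_rp2\<close> off the unit sphere is irrelevant.\<close>

instantiation rp2 :: topological_space
begin

definition open_rp2 :: "rp2 set \<Rightarrow> bool" where
  "open_rp2 U \<longleftrightarrow> openin (top_of_set (sphere 0 1)) {x \<in> sphere 0 1. abs_rp2 x \<in> U}"

instance
proof
  have "{x \<in> sphere 0 1. abs_rp2 x \<in> UNIV} = sphere 0 1"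
    by auto
  then show "open (UNIV :: rp2 set)"
    unfolding open_rp2_def by (simp only: openin_subtopology_self)
next
  fix U V :: "rp2 set"
  assume "open U" "open V"
  moreover have "{x \<in> sphere 0 1. abs_rp2 x \<in> U \<inter> V} =
      {x \<in> sphere 0 1. abs_rp2 x \<in> U} \<inter> {x \<in> sphere 0 1. abs_rp2 x \<in> V}"
    by auto
  ultimately show "open (U \<inter> V)"
    unfolding open_rp2_def by (simp only: openin_Int)
next
  fix K :: "rp2 set set"
  assume "\<forall>U\<in>K. open U"
  moreover have "{x \<in> sphere 0 1. abs_rp2 x \<in> \<Union>K} =
      (\<Union>U\<in>K. {x \<in> sphere 0 1. abs_rp2 x \<in> U})"
    by auto
  ultimately show "open (\<Union>K)"
    unfolding open_rp2_def by (auto intro: openin_Union)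
qed

end

lemma abs_rp2_eq_iff:
  assumes "x \<in> sphere 0 1" "y \<in> sphere 0 1"
  shows "abs_rp2 x = abs_rp2 y \<longleftrightarrow> y = x \<or> y = - x"
  using assms Quotient_rel[OF Quotient_rp2, of x y] by (auto simp: antipodal_rel_def)

lemma rep_rp2_in_sphere: "rep_rp2 P \<in> sphere 0 1"
  using Quotient_rep_reflp[OF Quotient_rp2, of P] by (simp add: antipodal_rel_def)

lemma abs_rp2_rep_rp2: "abs_rp2 (rep_rp2 P) = P"
  by (rule Quotient_abs_rep[OF Quotient_rp2])

lemma rep_rp2_abs_rp2:
  assumes "x \<in> sphere 0 1"
  shows "rep_rp2 (abs_rp2 x) = x \<or> rep_rp2 (abs_rp2 x) = - x"
  using abs_rp2_eq_iff[OF assms rep_rp2_in_sphere] abs_rp2_rep_rp2 by metis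

lemma image_abs_rp2_sphere: "abs_rp2 ` sphere 0 1 = UNIV"
  using rep_rp2_in_sphere abs_rp2_rep_rp2 by (metis UNIV_eq_I image_eqI)

lemma quotient_map_abs_rp2:
  "quotient_map (top_of_set (sphere 0 1)) (euclidean :: rp2 topology) abs_rp2"
  by (simp add: quotient_map_def image_abs_rp2_sphere open_rp2_def)

instance rp2 :: t2_space
proof
  fix P Q :: rp2
  assume "P \<noteq> Q"
  define x y where "x = rep_rp2 P" and "y = rep_rp2 Q"
  have x: "norm x = 1" "abs_rp2 x = P" and y: "norm y = 1" "abs_rp2 y = Q"
    using rep_rp2_in_sphere[of P] rep_rp2_in_sphere[of Q]
    by (simp_all add: x_def y_def abs_rp2_rep_rp2)
  have "y \<noteq> x" "y \<noteq> - x"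
    using \<open>P \<noteq> Q\<close> x y abs_rp2_eq_iff[of x y] by auto
  then have less: "\<bar>x \<bullet> y\<bar> < 1"
    using Cauchy_Schwarz_ineq2[of x y] norm_cauchy_schwarz_abs_eq[of x y] x y
    by (auto simp: less_le)
  have xx: "x \<bullet> x = 1" and yy: "y \<bullet> y = 1"
    using x y by (simp_all add: dot_square_norm)
  have opn: "open {R. \<bar>rep_rp2 R \<bullet> a\<bar> < \<bar>rep_rp2 R \<bullet> b\<bar>}" for a b :: "real ^ 3"
  proof -
    have "{z \<in> sphere 0 1. abs_rp2 z \<in> {R. \<bar>rep_rp2 R \<bullet> a\<bar> < \<bar>rep_rp2 R \<bullet> b\<bar>}} =
        sphere 0 1 \<inter> {z. \<bar>z \<bullet> a\<bar> < \<bar>z \<bullet> b\<bar>}"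
      using rep_rp2_abs_rp2 by fastforce
    moreover have "open {z. \<bar>z \<bullet> a\<bar> < \<bar>z \<bullet> b\<bar>}"
      by (intro open_Collect_less continuous_intros)
    ultimately show ?thesis
      by (simp add: open_rp2_def openin_open_Int)
  qed
  have "P \<in> {R. \<bar>rep_rp2 R \<bullet> y\<bar> < \<bar>rep_rp2 R \<bullet> x\<bar>}"
    using less xx by (simp flip: x_def)
  moreover have "Q \<in> {R. \<bar>rep_rp2 R \<bullet> x\<bar> < \<bar>rep_rp2 R \<bullet> y\<bar>}"
    using less yy by (simp add: inner_commute flip: y_def)
  ultimately show "\<exists>U V. open U \<and> open V \<and> P \<in> U \<and> Q \<in> V \<and> U \<inter> V = {}"
    using opn[of x y] opn[of y x]
    by (intro exI[of _ "{R. \<bar>rep_rp2 R \<bullet> y\<bar> < \<bar>rep_rp2 R \<bullet> x\<bar>}"]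
        exI[of _ "{R. \<bar>rep_rp2 R \<bullet> x\<bar> < \<bar>rep_rp2 R \<bullet> y\<bar>}"]) auto
qed


section \<open>Diameter graphs\<close>

text \<open>An undirected edge \<open>uv\<close> is represented by the two arcs \<open>(u, v)\<close> and \<open>(v, u)\<close>.\<close>

definition diameter_graph :: "'a::metric_space set \<Rightarrow> 'a pair_pre_digraph" where
  "diameter_graph S =
    \<lparr> pverts = S, parcs = {(u, v). u \<in> S \<and> v \<in> S \<and> u \<noteq> v \<and> dist u v = diameter S} \<rparr>"

lemma pair_graph_diameter_graph:
  assumes "finite S"
  shows "pair_graph (diameter_graph S)"
proof
  have "parcs (diameter_graph S) \<subseteq> S \<times> S"
    by (auto simp: diameter_graph_def)
  then show "finite (parcs (diameter_graph S))"
    using assms by (meson finite_SigmaI finite_subset)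
  show "symmetric (with_proj (diameter_graph S))"
    by (auto simp: symmetric_def sym_def diameter_graph_def dist_commute)
qed (use assms in \<open>auto simp: diameter_graph_def\<close>)


section \<open>Embedded graphs and noncontractible cycles\<close>

text \<open>\<open>\<phi> v\<close> is the point representing the vertex \<open>v\<close>, and \<open>\<gamma> (u, v)\<close> parametrises the curve
  representing the edge \<open>uv\<close> from \<open>\<phi> u\<close> to \<open>\<phi> v\<close>.  As the target space is Hausdorff, the
  injective paths \<open>\<gamma> a\<close> are homeomorphisms onto their images, and a finite graph is
  homeomorphic to the union of its vertex points and edge curves.\<close>

definition graph_embedding ::
  "'v pair_pre_digraph \<Rightarrow> ('v \<Rightarrow> 'b::t2_space) \<Rightarrow> ('v \<times> 'v \<Rightarrow> real \<Rightarrow> 'b) \<Rightarrow> bool" where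
  "graph_embedding G \<phi> \<gamma> \<longleftrightarrow>
    inj_on \<phi> (pverts G) \<and>
    (\<forall>(u, v) \<in> parcs G.
        arc (\<gamma> (u, v)) \<and> pathstart (\<gamma> (u, v)) = \<phi> u \<and> pathfinish (\<gamma> (u, v)) = \<phi> v \<and>
        \<gamma> (v, u) = reversepath (\<gamma> (u, v)) \<and>
        \<gamma> (u, v) ` {0<..<1} \<inter> \<phi> ` pverts G = {}) \<and>
    (\<forall>(u, v) \<in> parcs G. \<forall>(u', v') \<in> parcs G.
        {u, v} \<noteq> {u', v'} \<longrightarrow> \<gamma> (u, v) ` {0<..<1} \<inter> \<gamma> (u', v') ` {0<..<1} = {})"

fun joinpaths_list :: "(real \<Rightarrow> 'b::topological_space) list \<Rightarrow> real \<Rightarrow> 'b" where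
  "joinpaths_list [] = undefined"
| "joinpaths_list [g] = g"
| "joinpaths_list (g # h # gs) = g +++ joinpaths_list (h # gs)"

definition noncontractible_loop :: "(real \<Rightarrow> 'b::topological_space) \<Rightarrow> bool" where
  "noncontractible_loop g \<longleftrightarrow>
    path g \<and> pathfinish g = pathstart g \<and> \<not> (\<exists>c. homotopic_loops UNIV g (\<lambda>_. c))"

text \<open>A cycle is a closed walk, given by its list of arcs, that repeats no vertex.  The library
  also counts \<open>[(u, v), (v, u)]\<close> as a cycle, but in a loopfree graph every cycle of odd length
  has at least three arcs.\<close>

definition odd_cycle :: "'v pair_pre_digraph \<Rightarrow> ('v \<times> 'v) list \<Rightarrow> bool" where
  "odd_cycle G p \<longleftrightarrow> pre_digraph.cycle (with_proj G) p \<and> odd (length p)"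

end

theory Submission
  imports Defs
begin


text \<open>
  Let \<open>D\<close> be the diameter of \<open>S\<close>, and suppose that \<open>D > 0\<close>. The idea is to replace each edge by
  its direction. Seen from \<open>x\<close>, an edge \<open>xy\<close> has the direction \<open>y - x\<close>; seen from \<open>y\<close>, it has the
  opposite one. In the projective plane the two directions are the same point, so this point can
  serve as the midpoint of the edge, while a further direction \<open>\<rho> x\<close> chosen at each vertex \<open>x\<close> gives
  the place of the vertex. The half edge at \<open>x\<close> towards \<open>y\<close> is the image of the great circle arc
  from \<open>\<rho> x\<close> to \<open>y - x\<close>, and the edge \<open>xy\<close> consists of this half edge and the one at \<open>y\<close> towards \<open>x\<close>.

  Choose \<open>\<rho> x = p x - x\<close>, where \<open>p x\<close> has distance \<open>D\<close> from \<open>x\<close> and where all the points \<open>p x\<close> can be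
  added to \<open>S\<close> without increasing the diameter. For a point \<open>z\<close> other than \<open>x\<close>, the points of
  the sphere with centre \<open>x\<close> and radius \<open>D\<close> that are within \<open>D\<close> of \<open>z\<close> form a cap that is
  contained in an open hemisphere, hence spherically convex. Therefore each point of the arc from
  \<open>p x\<close> to \<open>y\<close> on that sphere is again within \<open>D\<close> of all points concerned (\<open>cap_convex\<close>). If half
  edges at two different points \<open>x\<close> and \<open>y\<close> meet in the projective plane, then vectors in the two
  cones are multiples of each other, by a negative factor, because those at \<open>x\<close> have a positive inner
  product with \<open>y - x\<close> and those at \<open>y\<close> a negative one. Scaled to length \<open>D\<close>, they are \<open>w\<close> and \<open>- w\<close>.
  So \<open>x + w\<close> and \<open>y - w\<close> are within \<open>D\<close> of each other, and this forces \<open>w = y - x\<close>: the half edges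
  belong to the edge \<open>xy\<close> and meet in its midpoint (\<open>antipodal_cones_meet\<close>, \<open>half_edges_other\<close>).

  Half edges at the same point \<open>x\<close> are arcs starting at \<open>\<rho> x\<close>; they meet nowhere else if \<open>\<rho> x\<close> lies
  in no plane spanned by the directions of two neighbours of \<open>x\<close>. If \<open>x\<close> has two neighbours, then \<open>p x\<close>
  can be chosen so generically, near the midpoint of the arc between them, because there all
  distances to points other than \<open>x\<close> are less than \<open>D\<close> (\<open>extend_generic\<close>). If
  \<open>x\<close> has a single neighbour \<open>y\<close>, then \<open>p x = y\<close> is admissible and the half edge at \<open>x\<close> shrinks to a point. This must not happen at both
  ends of an edge; so if \<open>xy\<close> is a component of the graph, one of its ends gets a generic
  direction. Isolated vertices are put at different points off the finitely many planes that carry half edges.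

  Now lift the drawing to the double cover by nonzero vectors: an edge \<open>xy\<close> lifts to a path
  from \<open>\<rho> x\<close> to \<open>y - x = - (x - y)\<close> and on to \<open>- \<rho> y\<close>. So a walk along an odd cycle that starts
  at \<open>u\<close> lifts to a path from \<open>\<rho> u\<close> to \<open>- \<rho> u\<close> (\<open>walk_lift\<close>), and a loop with such a lift is not
  contractible, by the homotopy lifting property (\<open>noncontractible_loop_of_antipodal_lift\<close>).
\<close>


section \<open>Points within a fixed distance of each other\<close>

lemma inner_ge_of_dist_le:
  fixes x a z :: "'a::real_inner"
  assumes "dist a x = D" "dist a z \<le> D"
  shows "(norm (z - x))\<^sup>2 / 2 \<le> (a - x) \<bullet> (z - x)"
proof -
  have "(norm ((a - x) - (z - x)))\<^sup>2 \<le> (norm (a - x))\<^sup>2"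
    using assms by (intro power_mono) (auto simp: dist_norm)
  then show ?thesis
    by (simp add: power2_norm_eq_inner inner_diff_left inner_diff_right inner_commute)
qed

lemma dist_le_of_inner_ge:
  fixes x w z :: "'a::real_inner"
  assumes "norm w = D" "(norm (z - x))\<^sup>2 / 2 \<le> w \<bullet> (z - x)"
  shows "dist (x + w) z \<le> D"
proof -
  have "(norm (w - (z - x)))\<^sup>2 \<le> (norm w)\<^sup>2"
    using assms(2)
    by (simp add: power2_norm_eq_inner inner_diff_left inner_diff_right inner_commute)
  then have "norm (w - (z - x)) \<le> norm w"
    by (rule power2_le_imp_le) simp
  then show ?thesis
    using assms(1) by (simp add: dist_norm algebra_simps)
qed

lemma dist_less_of_inner_gt:
  fixes x w z :: "'a::real_inner"
  assumes "norm w = D" "(norm (z - x))\<^sup>2 / 2 < w \<bullet> (z - x)"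
  shows "dist (x + w) z < D"
proof -
  have "(norm (w - (z - x)))\<^sup>2 < (norm w)\<^sup>2"
    using assms(2)
    by (simp add: power2_norm_eq_inner inner_diff_left inner_diff_right inner_commute)
  then have "norm (w - (z - x)) < norm w"
    by (rule power2_less_imp_less) simp
  then show ?thesis
    using assms(1) by (simp add: dist_norm algebra_simps)
qed

text \<open>Being within \<open>D\<close> of \<open>z\<close> is, for \<open>x + w\<close> with \<open>w\<close> of length \<open>D\<close>, the affine
  condition \<open>(norm (z - x))\<^sup>2 / 2 \<le> w \<bullet> (z - x)\<close>. A combination \<open>s *\<^sub>R u + t *\<^sub>R v\<close> of two vectors of length
  \<open>D\<close> that has itself length \<open>D\<close> satisfies \<open>1 \<le> s + t\<close> by the triangle inequality; as the bound is
  not negative, it is inherited.\<close>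
lemma cap_convex:
  fixes x a b z :: "'a::real_inner"
  assumes "dist a x = D" "dist b x = D" "dist a z \<le> D" "dist b z \<le> D"
    and "0 \<le> s" "0 \<le> t" and w: "norm (s *\<^sub>R (a - x) + t *\<^sub>R (b - x)) = D" and "0 < D"
  shows "dist (x + (s *\<^sub>R (a - x) + t *\<^sub>R (b - x))) z \<le> D"
proof (rule dist_le_of_inner_ge[OF w])
  have "D \<le> norm (s *\<^sub>R (a - x)) + norm (t *\<^sub>R (b - x))"
    using norm_triangle_ineq[of "s *\<^sub>R (a - x)" "t *\<^sub>R (b - x)"] w by simp
  also have "\<dots> = D * (s + t)"
    using assms by (simp add: dist_norm distrib_left mult.commute)
  finally have "D * 1 \<le> D * (s + t)"
    by simp
  then have "1 \<le> s + t"
    using \<open>0 < D\<close> by (simp only: mult_le_cancel_left_pos)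
  then have "1 * ((norm (z - x))\<^sup>2 / 2) \<le> (s + t) * ((norm (z - x))\<^sup>2 / 2)"
    by (intro mult_right_mono) auto
  also have "\<dots> \<le> s * ((a - x) \<bullet> (z - x)) + t * ((b - x) \<bullet> (z - x))"
    unfolding distrib_right using assms
    by (intro add_mono mult_left_mono inner_ge_of_dist_le) auto
  finally show "(norm (z - x))\<^sup>2 / 2 \<le> (s *\<^sub>R (a - x) + t *\<^sub>R (b - x)) \<bullet> (z - x)"
    by (simp add: inner_add_left)
qed

text \<open>The midpoint of the arc from \<open>a\<close> to \<open>b\<close>: there the coefficients \<open>s = t\<close> have
  a sum greater than \<open>1\<close>, so that the condition of \<open>inner_ge_of_dist_le\<close> holds with a strict
  inequality.\<close>
lemma cap_strictly_convex:
  fixes x a b :: "'a::real_inner"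
  assumes "dist a x = D" "dist b x = D" "a \<noteq> b" "0 < D"
    and X: "\<And>z. z \<in> X \<Longrightarrow> dist a z \<le> D \<and> dist b z \<le> D" and "b \<in> X"
  obtains m where "dist m x = D" "\<And>z. z \<in> X \<Longrightarrow> z \<noteq> x \<Longrightarrow> dist m z < D"
proof -
  define v where "v = (a - x) + (b - x)"
  have na: "norm (a - x) = D" and nb: "norm (b - x) = D"
    using assms by (auto simp: dist_norm)
  have "(norm v)\<^sup>2 + (norm (a - b))\<^sup>2 = 2 * (norm (a - x))\<^sup>2 + 2 * (norm (b - x))\<^sup>2"
    unfolding v_def
    by (simp add: power2_norm_eq_inner inner_diff_left inner_diff_right inner_add_left inner_add_right
        inner_commute)
  moreover have "0 < (norm (a - b))\<^sup>2"
    using \<open>a \<noteq> b\<close> by simp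
  ultimately have "(norm v)\<^sup>2 < (2 * D)\<^sup>2"
    by (simp add: na nb power2_eq_square)
  then have v2: "norm v < 2 * D"
    by (rule power2_less_imp_less) (use \<open>0 < D\<close> in simp)
  have "0 < (norm (b - x))\<^sup>2 / 2" 
    using nb \<open>0 < D\<close> by simp
  also have "\<dots> \<le> (a - x) \<bullet> (b - x)"
    using X[OF \<open>b \<in> X\<close>] assms by (intro inner_ge_of_dist_le) auto
  also have "\<dots> \<le> v \<bullet> (b - x)"
    by (simp add: v_def inner_add_left)
  finally have "v \<bullet> (b - x) > 0" .
  then have "v \<noteq> 0"
    by auto
  define c where "c = D / norm v"
  \<comment> \<open>The sum \<open>v\<close> of two different vectors of length \<open>D\<close> is shorter than \<open>2 * D\<close>.\<close>
  have c: "1 / 2 < c" 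
    using v2 \<open>v \<noteq> 0\<close> unfolding c_def by (subst less_divide_eq) auto
  show ?thesis
  proof
    have w: "norm (c *\<^sub>R v) = D"
      using \<open>v \<noteq> 0\<close> \<open>0 < D\<close> by (simp add: c_def)
    then show "dist (x + c *\<^sub>R v) x = D"
      by (simp add: dist_norm)
    fix z
    assume z: "z \<in> X" "z \<noteq> x"
    have *: "(norm (z - x))\<^sup>2 \<le> v \<bullet> (z - x)"
      using inner_ge_of_dist_le[of a x D z] inner_ge_of_dist_le[of b x D z] X[OF z(1)] assms
      by (simp add: v_def inner_add_left)
    have "(norm (z - x))\<^sup>2 / 2 < c * (norm (z - x))\<^sup>2"
      using c z by (simp add: field_simps)
    also have "\<dots> \<le> c *\<^sub>R v \<bullet> (z - x)"
      using * c by simp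
    finally show "dist (x + c *\<^sub>R v) z < D"
      by (rule dist_less_of_inner_gt[OF w])
  qed
qed


section \<open>Cones spanned by two directions\<close>

definition ray_cone :: "'a::real_vector \<Rightarrow> 'a \<Rightarrow> 'a set" where
  "ray_cone u v = {s *\<^sub>R u + t *\<^sub>R v | s t. 0 \<le> s \<and> 0 \<le> t \<and> s *\<^sub>R u + t *\<^sub>R v \<noteq> 0}"

lemma ray_coneE:
  assumes "w \<in> ray_cone u v"
  obtains s t where "w = s *\<^sub>R u + t *\<^sub>R v" "0 \<le> s" "0 \<le> t" "w \<noteq> 0"
  using assms by (auto simp: ray_cone_def)

lemma ray_coneI:
  "0 \<le> s \<Longrightarrow> 0 \<le> t \<Longrightarrow> s *\<^sub>R u + t *\<^sub>R v \<noteq> 0 \<Longrightarrow> s *\<^sub>R u + t *\<^sub>R v \<in> ray_cone u v"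
  by (auto simp: ray_cone_def)

lemma ray_cone_scale:
  assumes "w \<in> ray_cone u v" "0 < c"
  shows "c *\<^sub>R w \<in> ray_cone u v"
proof -
  obtain s t where w: "w = s *\<^sub>R u + t *\<^sub>R v" "0 \<le> s" "0 \<le> t" "w \<noteq> 0"
    using assms(1) by (rule ray_coneE)
  then have eq: "c *\<^sub>R w = (c * s) *\<^sub>R u + (c * t) *\<^sub>R v"
    by (simp add: scaleR_add_right)
  have "c *\<^sub>R w \<noteq> 0"
    using w(4) assms(2) by simp
  then show ?thesis
    using w(2,3) assms(2) unfolding eq by (intro ray_coneI) auto
qed

lemma ray_cone_inner_pos:
  assumes "w \<in> ray_cone u v" "0 < u \<bullet> d" "0 < v \<bullet> d"
  shows "0 < w \<bullet> d"
proof -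
  obtain s t where w: "w = s *\<^sub>R u + t *\<^sub>R v" "0 \<le> s" "0 \<le> t" "w \<noteq> 0"
    using assms(1) by (rule ray_coneE)
  then have "0 < s \<or> 0 < t"
    by (cases "s = 0") auto
  then show ?thesis
    using assms w by (auto simp: inner_add_left add_pos_nonneg add_nonneg_pos)
qed

text \<open>Scale \<open>v\<close> to a vector \<open>w\<close> of length \<open>D\<close>. By convexity of caps \<open>x + w\<close> is within \<open>D\<close> of
  \<open>q\<close> and \<open>b\<close>, hence \<open>y - w\<close> is within \<open>D\<close> of \<open>x + w\<close>, that is, \<open>norm (y - x - 2 *\<^sub>R w) \<le> D\<close>. But
  \<open>2 *\<^sub>R w\<close> has length \<open>2 * D\<close> and \<open>y - x\<close> at most \<open>D\<close>; so there is equality in the triangle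
  inequality, and \<open>w = y - x\<close>.\<close>
lemma antipodal_cones_meet:
  fixes x y p a q b :: "'a::real_inner"
  assumes D: "0 < D"
    and x: "dist p x = D" "dist a x = D" and y: "dist q y = D" "dist b y = D"
    and d: "dist x y \<le> D" "dist p y \<le> D" "dist a y \<le> D" "dist x q \<le> D" "dist x b \<le> D"
      "dist p q \<le> D" "dist p b \<le> D" "dist a q \<le> D" "dist a b \<le> D"
    and v: "v \<in> ray_cone (p - x) (a - x)" and cv: "- (c *\<^sub>R v) \<in> ray_cone (q - y) (b - y)" "0 < c"
  shows "dist x y = D \<and> (\<exists>k>0. v = k *\<^sub>R (y - x))"
proof -
  have "v \<noteq> 0"
    using v by (auto elim: ray_coneE)
  define w where "w = (D / norm v) *\<^sub>R v"
  have nw: "norm w = D"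
    using \<open>v \<noteq> 0\<close> D by (simp add: w_def)
  have "w \<in> ray_cone (p - x) (a - x)"
    unfolding w_def using v \<open>v \<noteq> 0\<close> D by (intro ray_cone_scale) auto
  then obtain s t where w: "w = s *\<^sub>R (p - x) + t *\<^sub>R (a - x)" "0 \<le> s" "0 \<le> t"
    by (auto elim: ray_coneE)
  have "- w = (D / norm v / c) *\<^sub>R (- (c *\<^sub>R v))"
    using cv by (simp add: w_def)
  then have "- w \<in> ray_cone (q - y) (b - y)"
    using cv \<open>v \<noteq> 0\<close> D by (simp only:) (intro ray_cone_scale, auto)
  then obtain s' t' where w': "- w = s' *\<^sub>R (q - y) + t' *\<^sub>R (b - y)" "0 \<le> s'" "0 \<le> t'"
    by (auto elim: ray_coneE)
  have xw: "dist (x + w) z \<le> D" if "dist p z \<le> D" "dist a z \<le> D" for z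
    using cap_convex[of p x D a z s t] that w x nw D by simp
  have "dist (y + - w) (x + w) \<le> D"
    unfolding w'(1)
  proof (rule cap_convex)
    show "norm (s' *\<^sub>R (q - y) + t' *\<^sub>R (b - y)) = D"
      using nw unfolding w'(1)[symmetric] by simp
  qed (use xw[of q] xw[of b] w' y D d in \<open>auto simp: dist_commute\<close>)
  then have "(norm (y + - w - (x + w)))\<^sup>2 \<le> D\<^sup>2"
    by (auto simp: dist_norm intro: power_mono)
  moreover have "(norm w)\<^sup>2 = D\<^sup>2"
    by (simp add: nw)
  ultimately have 1: "3 * D\<^sup>2 + (norm (y - x))\<^sup>2 \<le> 4 * (w \<bullet> (y - x))"
    by (simp add: power2_norm_eq_inner inner_diff_left inner_diff_right inner_add_left
        inner_add_right inner_commute algebra_simps)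
  have dxy: "(norm (y - x))\<^sup>2 \<le> D\<^sup>2"
    using d(1) by (intro power_mono) (auto simp: dist_norm norm_minus_commute)
  have 2: "(norm (w - (y - x)))\<^sup>2 = D\<^sup>2 + (norm (y - x))\<^sup>2 - 2 * (w \<bullet> (y - x))"
    using \<open>(norm w)\<^sup>2 = D\<^sup>2\<close>
    by (simp add: power2_norm_eq_inner inner_diff_left inner_diff_right inner_add_left
        inner_add_right inner_commute algebra_simps)
  then have "(norm (w - (y - x)))\<^sup>2 \<le> 0"
    using 1 dxy by linarith
  then have "w = y - x"
    by simp
  moreover have "v = (norm v / D) *\<^sub>R w"
    using \<open>v \<noteq> 0\<close> D by (simp add: w_def)
  ultimately show ?thesis
    using nw \<open>v \<noteq> 0\<close> D by (auto simp: dist_norm norm_minus_commute intro!: exI[of _ "norm v / D"])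
qed


section \<open>Directions off finitely many planes\<close>

lemma exists_off_hyperplanes:
  fixes U :: "'a::euclidean_space set"
  assumes "open U" "U \<noteq> {}" "finite F" "0 \<notin> F"
  obtains v where "v \<in> U" "\<And>n. n \<in> F \<Longrightarrow> n \<bullet> v \<noteq> 0"
proof -
  have "negligible (\<Union>n\<in>F. {v. n \<bullet> v = 0})"
    using assms by (intro negligible_Union) (auto intro!: negligible_hyperplane)
  then have "\<not> U \<subseteq> (\<Union>n\<in>F. {v. n \<bullet> v = 0})"
    using open_not_negligible[OF assms(1,2)] negligible_subset by blast
  then show ?thesis
    using that by auto
qed

lemma exists_normal:
  fixes a b :: "real ^ 3"
  obtains n where "n \<noteq> 0" "n \<bullet> a = 0" "n \<bullet> b = 0"
proof -
  have "dim (span {a, b}) \<le> card {a, b}"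
    by (simp add: dim_le_card')
  also have "\<dots> < DIM(real ^ 3)"
    by (simp add: card_insert_if)
  finally have "dim {a, b} < DIM(real ^ 3)"
    by simp
  then obtain n where "n \<noteq> 0" "\<And>y. y \<in> span {a, b} \<Longrightarrow> orthogonal n y"
    using orthogonal_to_subspace_exists by blast
  then show ?thesis
    using that by (auto simp: orthogonal_def span_base)
qed

text \<open>The strict inequalities survive a small change of \<open>m\<close> on the sphere around
  \<open>x\<close>, and an open set of directions is not covered by finitely many hyperplanes.\<close>
lemma perturb_on_sphere:
  fixes x m :: "'a::euclidean_space"
  assumes "finite X" "dist m x = D" "0 < D" and m: "\<And>z. z \<in> X \<Longrightarrow> z \<noteq> x \<Longrightarrow> dist m z < D"
    and F: "finite F" "0 \<notin> F"
  obtains p where "dist p x = D" "\<And>z. z \<in> X \<Longrightarrow> z \<noteq> x \<Longrightarrow> dist p z < D"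
    "\<And>n. n \<in> F \<Longrightarrow> n \<bullet> (p - x) \<noteq> 0"
proof -
  let ?f = "\<lambda>v. x + D *\<^sub>R sgn v"
  have nm: "norm (m - x) = D"
    using assms by (simp add: dist_norm)
  then have "m - x \<noteq> 0" and fm: "?f (m - x) = m"
    using assms by (auto simp: sgn_div_norm)
  have "(?f \<longlongrightarrow> ?f (m - x)) (nhds (m - x))"
    using \<open>m - x \<noteq> 0\<close>
    by (intro tendsto_add tendsto_const tendsto_scaleR tendsto_sgn filterlim_ident)
  then have lim: "(?f \<longlongrightarrow> m) (nhds (m - x))"
    by (simp only: fm)
  have "eventually (\<lambda>v. \<forall>z\<in>X - {x}. dist (?f v) z < D) (nhds (m - x))"
    using assms(1) m
    by (intro eventually_ball_finite ballI order_tendstoD(2)[OF tendsto_dist[OF lim tendsto_const]]) auto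
  moreover have "eventually (\<lambda>v. v \<noteq> 0) (nhds (m - x))"
    using \<open>m - x \<noteq> 0\<close> by (rule t1_space_nhds)
  ultimately have "eventually (\<lambda>v. (\<forall>z\<in>X - {x}. dist (?f v) z < D) \<and> v \<noteq> 0) (nhds (m - x))"
    by (rule eventually_conj)
  then obtain U where U: "open U" "m - x \<in> U"
      "\<And>v. v \<in> U \<Longrightarrow> (\<forall>z\<in>X - {x}. dist (?f v) z < D) \<and> v \<noteq> 0"
    unfolding eventually_nhds by blast
  then obtain v where v: "v \<in> U" "\<And>n. n \<in> F \<Longrightarrow> n \<bullet> v \<noteq> 0"
    using exists_off_hyperplanes[OF U(1) _ F] by blast
  show ?thesis
  proof
    show "dist (?f v) x = D"
      using U(3)[OF v(1)] \<open>0 < D\<close> by (simp add: dist_norm norm_sgn)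
    show "dist (?f v) z < D" if "z \<in> X" "z \<noteq> x" for z
      using U(3)[OF v(1)] that by auto
    show "n \<bullet> (?f v - x) \<noteq> 0" if "n \<in> F" for n
      using U(3)[OF v(1)] v(2)[OF that] \<open>0 < D\<close> by (auto simp: sgn_div_norm)
  qed
qed


section \<open>Adding generic points without increasing the diameter\<close>

locale diameter_set =
  fixes S :: "(real ^ 3) set" and D :: real
  assumes finite_S: "finite S" and D_pos: "0 < D"
    and dist_le: "x \<in> S \<Longrightarrow> y \<in> S \<Longrightarrow> dist x y \<le> D"
begin

definition nbrs :: "real ^ 3 \<Rightarrow> (real ^ 3) set" where
  "nbrs x = {a \<in> S. dist a x = D}"

lemma nbrs_sym: "x \<in> S \<Longrightarrow> a \<in> nbrs x \<Longrightarrow> x \<in> nbrs a"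
  by (auto simp: nbrs_def dist_commute)

lemma nbrs_subset: "a \<in> nbrs x \<Longrightarrow> a \<in> S"
  by (auto simp: nbrs_def)

lemma nbrs_neq: "a \<in> nbrs x \<Longrightarrow> a \<noteq> x"
  using D_pos by (auto simp: nbrs_def)

lemma nbrs_norm: "a \<in> nbrs x \<Longrightarrow> norm (a - x) = D"
  by (auto simp: nbrs_def dist_norm)

text \<open>The vector \<open>q - x\<close> lies in no span of \<open>a - x\<close> and \<open>b - x\<close> for neighbours \<open>a\<close>, \<open>b\<close> of \<open>x\<close>, as
  witnessed by normal vectors. The case \<open>a = b\<close> keeps it off the lines through the neighbours.\<close>
definition off_planes :: "real ^ 3 \<Rightarrow> real ^ 3 \<Rightarrow> bool" where
  "off_planes x q \<longleftrightarrow> (\<forall>a\<in>nbrs x. \<forall>b\<in>nbrs x. \<exists>n. n \<bullet> (a - x) = 0 \<and> n \<bullet> (b - x) = 0 \<and> n \<bullet> (q - x) \<noteq> 0)"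

lemma off_planesD:
  assumes "off_planes x q" "a \<in> nbrs x" "b \<in> nbrs x"
  obtains n where "n \<bullet> (a - x) = 0" "n \<bullet> (b - x) = 0" "n \<bullet> (q - x) \<noteq> 0"
  using assms unfolding off_planes_def by blast

text \<open>The new points are chosen one after the other. The inequality towards old points other
  than \<open>x\<close> is kept strict: a point \<open>y\<close> as in the second alternative is then at distance less than \<open>D\<close> from the new
  points chosen before, so that it can be perturbed itself. New points are only required to be within
  \<open>D\<close> of each other.\<close>
lemma extend_generic:
  assumes "finite T" "T \<subseteq> S"
    and room: "\<And>x. x \<in> T \<Longrightarrow> (\<exists>a\<in>nbrs x. \<exists>b\<in>nbrs x. a \<noteq> b) \<or> (\<exists>y. nbrs x = {y} \<and> nbrs y = {x} \<and> y \<notin> T)"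
  shows "\<exists>p. \<forall>x\<in>T. dist (p x) x = D \<and> off_planes x (p x) \<and>
    (\<forall>z\<in>S. z \<noteq> x \<longrightarrow> dist (p x) z < D) \<and> (\<forall>y\<in>T. dist (p x) (p y) \<le> D)"
  using assms
proof (induction T rule: finite_induct)
  case empty
  then show ?case by simp
next
  case (insert x T)
  have "\<And>x. x \<in> T \<Longrightarrow> (\<exists>a\<in>nbrs x. \<exists>b\<in>nbrs x. a \<noteq> b) \<or> (\<exists>y. nbrs x = {y} \<and> nbrs y = {x} \<and> y \<notin> T)"
    using insert.prems(2) by blast
  then have "\<exists>p. \<forall>x\<in>T. dist (p x) x = D \<and> off_planes x (p x) \<and>
    (\<forall>z\<in>S. z \<noteq> x \<longrightarrow> dist (p x) z < D) \<and> (\<forall>y\<in>T. dist (p x) (p y) \<le> D)"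
    using insert.prems(1) by (intro insert.IH) auto
  then obtain p where p: "\<And>x. x \<in> T \<Longrightarrow> dist (p x) x = D"
      "\<And>x. x \<in> T \<Longrightarrow> off_planes x (p x)"
      "\<And>x z. x \<in> T \<Longrightarrow> z \<in> S \<Longrightarrow> z \<noteq> x \<Longrightarrow> dist (p x) z < D"
      "\<And>x y. x \<in> T \<Longrightarrow> y \<in> T \<Longrightarrow> dist (p x) (p y) \<le> D"
    by blast
  \<comment> \<open>The points that the new one has to be within \<open>D\<close> of.\<close>
  define X where "X = S \<union> p ` T"
  have "finite X"
    using finite_S insert.hyps by (simp add: X_def)
  have near: "dist a z \<le> D" if "a \<in> S" "z \<in> X" for a z
  proof (cases "z \<in> S")
    case False
    then obtain w where w: "w \<in> T" "z = p w"
      using \<open>z \<in> X\<close> by (auto simp: X_def)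
    then show ?thesis
      using p(1)[of w] p(3)[of w a] \<open>a \<in> S\<close> by (cases "a = w") (auto simp: dist_commute)
  qed (use that dist_le in auto)
  obtain m where m: "dist m x = D" "\<And>z. z \<in> X \<Longrightarrow> z \<noteq> x \<Longrightarrow> dist m z < D"
  proof -
    consider a b where "a \<in> nbrs x" "b \<in> nbrs x" "a \<noteq> b"
      | y where "nbrs x = {y}" "nbrs y = {x}" "y \<notin> insert x T"
      using insert.prems(2)[of x] by blast
    then show thesis
    proof cases
      case (1 a b)
      then have "b \<in> X" "a \<in> S" "b \<in> S" "dist a x = D" "dist b x = D"
        by (auto simp: X_def nbrs_def)
      show thesis
      proof (rule cap_strictly_convex[of a x D b X])
        show "dist a z \<le> D \<and> dist b z \<le> D" if "z \<in> X" for z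
          using near that \<open>a \<in> S\<close> \<open>b \<in> S\<close> by blast
        fix m'
        assume "dist m' x = D" "\<And>z. z \<in> X \<Longrightarrow> z \<noteq> x \<Longrightarrow> dist m' z < D"
        then show thesis
          by (rule that)
      qed (fact | rule D_pos)+
    next
      case (2 y)
      then have y: "y \<in> S" "dist y x = D"
        by (auto simp: nbrs_def)
      show thesis
      proof (rule that[OF y(2)])
        fix z
        assume z: "z \<in> X" "z \<noteq> x"
        show "dist y z < D"
        proof (cases "z \<in> S")
          case True
          then have "z \<notin> nbrs y"
            using 2 z by auto
          then show ?thesis
            using dist_le[OF y(1) True] True by (auto simp: nbrs_def dist_commute)
        next
          case False
          then obtain w where "w \<in> T" "z = p w"
            using z by (auto simp: X_def)
          moreover from this have "w \<noteq> y"
            using 2 by auto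
          ultimately show ?thesis
            using p(3)[of w y] y by (auto simp: dist_commute)
        qed
      qed
    qed
  qed
  define nrm where "nrm = (\<lambda>(a, b). SOME n. n \<noteq> 0 \<and> n \<bullet> (a - x) = 0 \<and> n \<bullet> (b - x) = 0)"
  have nrm: "nrm (a, b) \<noteq> 0 \<and> nrm (a, b) \<bullet> (a - x) = 0 \<and> nrm (a, b) \<bullet> (b - x) = 0" for a b
    unfolding nrm_def prod.case by (rule someI_ex) (metis exists_normal)
  have "finite (nbrs x)"
    using finite_S by (simp add: nbrs_def)
  then have F: "finite (nrm ` (nbrs x \<times> nbrs x))" "0 \<notin> nrm ` (nbrs x \<times> nbrs x)"
    using nrm by auto
  obtain q where q: "dist q x = D" "\<And>z. z \<in> X \<Longrightarrow> z \<noteq> x \<Longrightarrow> dist q z < D"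
    "\<And>n. n \<in> nrm ` (nbrs x \<times> nbrs x) \<Longrightarrow> n \<bullet> (q - x) \<noteq> 0"
    using perturb_on_sphere[OF \<open>finite X\<close> m(1) D_pos m(2) F] by blast
  have off: "off_planes x q"
    unfolding off_planes_def
  proof (intro ballI)
    fix a b
    assume "a \<in> nbrs x" "b \<in> nbrs x"
    then show "\<exists>n. n \<bullet> (a - x) = 0 \<and> n \<bullet> (b - x) = 0 \<and> n \<bullet> (q - x) \<noteq> 0"
      using nrm[of a b] q(3)[of "nrm (a, b)"] by blast
  qed
  have qX: "dist q z \<le> D" if "z \<in> X" for z
    using q(1) q(2)[OF that] by (cases "z = x") auto
  show ?case
  proof (intro exI[of _ "p(x := q)"] ballI conjI impI)
    fix w assume w: "w \<in> insert x T"
    show "dist ((p(x := q)) w) w = D" "off_planes w ((p(x := q)) w)"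
      using w q(1) off p(1,2) by auto
    show "dist ((p(x := q)) w) z < D" if "z \<in> S" "z \<noteq> w" for z
      using w that q(2)[of z] p(3)[of w z] by (auto simp: X_def)
    show "dist ((p(x := q)) w) ((p(x := q)) y) \<le> D" if "y \<in> insert x T" for y
      using w that qX[of "p y"] qX[of "p w"] p(4)[of w y] D_pos
      by (auto simp: X_def dist_commute)
  qed
qed

end

text \<open>The second alternative in \<open>p_generic\<close> is that of a vertex of degree one whose half edge
  is collapsed by \<open>p x\<close> being its neighbour; \<open>p_asym\<close> says that an edge is never collapsed
  from both ends.\<close>
locale extended_diameter_set = diameter_set S D
  for S :: "(real ^ 3) set" and D +
  fixes p :: "real ^ 3 \<Rightarrow> real ^ 3"
  assumes p_dist: "x \<in> S \<Longrightarrow> nbrs x \<noteq> {} \<Longrightarrow> dist (p x) x = D"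
    and p_near: "x \<in> S \<Longrightarrow> nbrs x \<noteq> {} \<Longrightarrow> z \<in> S \<Longrightarrow> dist (p x) z \<le> D"
    and p_near_p: "x \<in> S \<Longrightarrow> nbrs x \<noteq> {} \<Longrightarrow> y \<in> S \<Longrightarrow> nbrs y \<noteq> {} \<Longrightarrow> dist (p x) (p y) \<le> D"
    and p_generic: "x \<in> S \<Longrightarrow> off_planes x (p x) \<or> nbrs x = {p x} \<or> nbrs x = {}"
    and p_asym: "x \<in> S \<Longrightarrow> y \<in> nbrs x \<Longrightarrow> p x = y \<Longrightarrow> p y \<noteq> x"

text \<open>Generic directions are given to the vertices of degree at least two and, in each edge that is
  a component of the graph, to the end with the smaller number \<open>f\<close>. Any other vertex has no
  neighbour or a single one, which then is a suitable \<open>p'\<close>.\<close>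
lemma (in diameter_set) extension_exists:
  obtains p where "extended_diameter_set S D p"
proof -
  obtain f :: "real ^ 3 \<Rightarrow> nat" where f: "inj_on f S"
    using finite_imp_inj_to_nat_seg[OF finite_S] by blast
  define T where "T = {x \<in> S. (\<exists>a\<in>nbrs x. \<exists>b\<in>nbrs x. a \<noteq> b) \<or>
    (\<exists>y. nbrs x = {y} \<and> nbrs y = {x} \<and> f x < f y)}"
  have "finite T" "T \<subseteq> S"
    using finite_S by (auto simp: T_def)
  moreover have "(\<exists>a\<in>nbrs x. \<exists>b\<in>nbrs x. a \<noteq> b) \<or> (\<exists>y. nbrs x = {y} \<and> nbrs y = {x} \<and> y \<notin> T)"
    if "x \<in> T" for x
  proof (cases "\<exists>a\<in>nbrs x. \<exists>b\<in>nbrs x. a \<noteq> b")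
    case False
    have "(\<exists>a\<in>nbrs x. \<exists>b\<in>nbrs x. a \<noteq> b) \<or> (\<exists>y. nbrs x = {y} \<and> nbrs y = {x} \<and> f x < f y)"
      using that by (simp only: T_def mem_Collect_eq)
    with False have "\<exists>y. nbrs x = {y} \<and> nbrs y = {x} \<and> f x < f y"
      by (simp only: simp_thms)
    then obtain y where y: "nbrs x = {y}" "nbrs y = {x}" "f x < f y"
      by (elim exE conjE)
    then have "y \<notin> T"
      by (auto simp: T_def)
    with y show ?thesis
      by (intro disjI2 exI[of _ y] conjI)
  qed (rule disjI1)
  ultimately have "\<exists>p. \<forall>x\<in>T. dist (p x) x = D \<and> off_planes x (p x) \<and>
    (\<forall>z\<in>S. z \<noteq> x \<longrightarrow> dist (p x) z < D) \<and> (\<forall>y\<in>T. dist (p x) (p y) \<le> D)"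
    by (rule extend_generic)
  then obtain p where p: "\<And>x. x \<in> T \<Longrightarrow> dist (p x) x = D"
      "\<And>x. x \<in> T \<Longrightarrow> off_planes x (p x)"
      "\<And>x z. x \<in> T \<Longrightarrow> z \<in> S \<Longrightarrow> z \<noteq> x \<Longrightarrow> dist (p x) z < D"
      "\<And>x y. x \<in> T \<Longrightarrow> y \<in> T \<Longrightarrow> dist (p x) (p y) \<le> D"
    by blast
  define p' where "p' x = (if x \<in> T then p x else SOME y. y \<in> nbrs x)" for x
  have out: "nbrs x = {p' x}" if "x \<in> S" "nbrs x \<noteq> {}" "x \<notin> T" for x
  proof -
    have "\<And>a b. a \<in> nbrs x \<Longrightarrow> b \<in> nbrs x \<Longrightarrow> a = b"
      using that by (auto simp: T_def)
    moreover have "p' x \<in> nbrs x"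
      using that by (auto simp: p'_def some_in_eq)
    ultimately show ?thesis
      by blast
  qed
  have pS: "dist (p x) z \<le> D" if "x \<in> T" "z \<in> S" for x z
    using p(1)[of x] p(3)[of x z] that by (cases "z = x") auto
  have pS': "dist (p' x) z \<le> D" if "x \<in> S" "nbrs x \<noteq> {}" "z \<in> S" for x z
  proof (cases "x \<in> T")
    case False
    then show ?thesis
      using out[OF that(1,2)] that(3) nbrs_subset[of "p' x" x] dist_le by auto
  qed (use pS that in \<open>auto simp: p'_def\<close>)
  show ?thesis
  proof (rule that, unfold_locales)
    show "dist (p' x) x = D" if "x \<in> S" "nbrs x \<noteq> {}" for x
    proof (cases "x \<in> T")
      case False
      then have "p' x \<in> nbrs x"
        using out that by auto
      then show ?thesis
        by (auto simp: nbrs_def)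
    qed (use p in \<open>auto simp: p'_def\<close>)
    show "dist (p' x) (p' y) \<le> D" if "x \<in> S" "nbrs x \<noteq> {}" "y \<in> S" "nbrs y \<noteq> {}" for x y
    proof (cases "x \<in> T \<and> y \<in> T")
      case True
      then show ?thesis
        using p(4) by (auto simp: p'_def)
    next
      case False
      then have "p' x \<in> S \<or> p' y \<in> S"
        using out[of x] out[of y] that nbrs_subset[of "p' x" x] nbrs_subset[of "p' y" y] by auto
      then show ?thesis
        using pS' that by (metis dist_commute)
    qed
    show "off_planes x (p' x) \<or> nbrs x = {p' x} \<or> nbrs x = {}" if "x \<in> S" for x
      using out[of x] p(2)[of x] that by (auto simp: p'_def)
    show "p' y \<noteq> x" if xy: "x \<in> S" "y \<in> nbrs x" "p' x = y" for x y
    proof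
      assume "p' y = x"
      have y: "y \<in> S" "x \<in> nbrs y"
        using nbrs_sym[OF xy(1,2)] nbrs_subset[OF xy(2)] by auto
      have neq: "p' u \<noteq> v" if "u \<in> T" "v \<in> nbrs u" for u v
      proof
        assume "p' u = v"
        then have "p u = v"
          using that by (simp add: p'_def)
        then show False
          using off_planesD[OF p(2)[OF that(1)] that(2) that(2)] by blast
      qed
      have nT: "x \<notin> T" "y \<notin> T"
        using neq[of x y] neq[of y x] xy y \<open>p' y = x\<close> by auto
      then have NN: "nbrs x = {y}" "nbrs y = {x}"
        using out[of x] out[of y] xy y \<open>p' y = x\<close> by auto
      have "f x \<noteq> f y"
        using f xy y nbrs_neq[of y x] by (auto dest: inj_onD)
      then show False
        using nT NN xy y by (auto simp: T_def)
    qed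
  qed (rule pS')
qed


section \<open>The double cover of the projective plane\<close>

definition proj :: "real ^ 3 \<Rightarrow> rp2" where
  "proj v = abs_rp2 (sgn v)"

lemma sgn_in_sphere: "v \<noteq> 0 \<Longrightarrow> sgn v \<in> sphere (0 :: 'a::real_normed_vector) 1"
  by (simp add: norm_sgn)

lemma proj_scale: "c \<noteq> 0 \<Longrightarrow> proj (c *\<^sub>R v) = proj v"
proof (cases "v = 0")
  case False
  assume "c \<noteq> 0"
  then have "sgn (c *\<^sub>R v) = sgn v \<or> sgn (c *\<^sub>R v) = - sgn v"
    by (simp add: sgn_scaleR sgn_real_def)
  then show ?thesis
    using False sgn_in_sphere[OF False] abs_rp2_eq_iff[of "sgn v" "sgn (c *\<^sub>R v)"]
    by (auto simp: proj_def)
qed simp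

lemma proj_minus: "proj (- v) = proj v"
  using proj_scale[of "- 1" v] by simp

lemma proj_eqE:
  assumes "v \<noteq> 0" "w \<noteq> 0" "proj v = proj w"
  obtains c where "c \<noteq> 0" "w = c *\<^sub>R v"
proof -
  have "sgn w = sgn v \<or> sgn w = - sgn v"
    using assms abs_rp2_eq_iff[of "sgn v" "sgn w"] sgn_in_sphere[of v] sgn_in_sphere[of w]
    by (auto simp: proj_def)
  moreover have "w = norm w *\<^sub>R sgn w"
    using assms by (simp add: sgn_div_norm)
  moreover have "norm w *\<^sub>R sgn v = (norm w / norm v) *\<^sub>R v"
    by (simp add: sgn_div_norm divide_inverse)
  ultimately have "w = (norm w / norm v) *\<^sub>R v \<or> w = (- (norm w / norm v)) *\<^sub>R v"
    by (elim disjE) (simp_all only: scaleR_minus_left scaleR_minus_right, simp_all)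
  then show thesis
    using that[of "norm w / norm v"] that[of "- (norm w / norm v)"] assms by auto
qed

lemma continuous_on_abs_rp2: "continuous_on (sphere 0 1) abs_rp2"
  using quotient_imp_continuous_map[OF quotient_map_abs_rp2] by simp

lemma continuous_on_proj: "continuous_on (- {0}) proj"
proof -
  have "continuous_on (- {0}) (abs_rp2 \<circ> sgn)"
    by (intro continuous_on_compose continuous_on_subset[OF continuous_on_abs_rp2])
      (auto intro!: continuous_intros simp: norm_sgn split: if_splits)
  then show ?thesis
    by (simp add: proj_def[abs_def] o_def)
qed

definition outer :: "real ^ 'n \<Rightarrow> real ^ 'n ^ 'n" where
  "outer x = (\<chi> i j. x $ i * x $ j)"

lemma outer_mult: "outer x *v y = (x \<bullet> y) *\<^sub>R x"
  by (simp add: vec_eq_iff outer_def matrix_vector_mult_def inner_vec_def sum_distrib_left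
      sum_distrib_right mult_ac)

lemma outer_minus: "outer (- x) = outer x"
  by (simp add: outer_def)

lemma outer_eq_inner:
  assumes "x \<in> sphere 0 1" "outer x = outer y"
  shows "x \<bullet> y = 1 \<or> x \<bullet> y = - 1"
proof -
  have "x \<bullet> (outer y *v x) = x \<bullet> (outer x *v x)"
    using assms by simp
  then have "(x \<bullet> y)\<^sup>2 = 1"
    using assms(1) by (simp add: outer_mult inner_commute power2_eq_square dot_square_norm)
  then show ?thesis
    by (simp add: power2_eq_1_iff)
qed

lemma continuous_on_outer: "continuous_on A (outer :: real ^ 'n \<Rightarrow> _)"
  unfolding outer_def[abs_def] by (intro continuous_intros)

lemma continuous_on_matrix_vector_left:
  fixes a :: "real ^ 'n"
  shows "continuous_on A (\<lambda>M :: real ^ 'n ^ 'm. M *v a)"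
  unfolding matrix_vector_mult_def by (intro continuous_intros)

text \<open>The matrix \<open>x x\<^sup>T\<close> of a unit vector \<open>x\<close> determines \<open>x\<close> up to sign, so its values form a copy of
  projective space inside a Euclidean space. Near \<open>outer a\<close> the two local inverses are
  \<open>K \<mapsto> e *\<^sub>R sgn (K *v a)\<close> with \<open>e\<close> either \<open>1\<close> or \<open>- 1\<close>, because \<open>outer x *v a\<close> is the multiple of \<open>x\<close> by
  \<open>x \<bullet> a\<close>.\<close>
lemma covering_space_outer:
  "covering_space (sphere 0 1) outer (outer ` sphere (0 :: real ^ 'n) 1)"
proof
  fix M
  assume "M \<in> outer ` sphere (0 :: real ^ 'n) 1"
  then obtain a :: "real ^ 'n" where a: "a \<in> sphere 0 1" "M = outer a"
    by blast
  define T where "T = outer ` sphere (0 :: real ^ 'n) 1 \<inter> {K. 0 < a \<bullet> (K *v a)}"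
  define U :: "real \<Rightarrow> (real ^ 'n) set" where "U e = sphere 0 1 \<inter> {y. 0 < e * (y \<bullet> a)}" for e
  have outer_T: "outer y \<in> T \<longleftrightarrow> y \<bullet> a \<noteq> 0" if "y \<in> sphere 0 1" for y
    using that by (auto simp: T_def outer_mult inner_commute zero_less_mult_iff)
  have hom: "homeomorphism (U e) T outer (\<lambda>K. e *\<^sub>R sgn (K *v a))" if "e = 1 \<or> e = - 1" for e
  proof (rule homeomorphismI)
    have q: "e *\<^sub>R sgn (outer y *v a) = y" if "y \<in> U e" for y
    proof -
      have "y \<in> sphere 0 1" "e * sgn (y \<bullet> a) = 1"
        using that \<open>e = 1 \<or> e = - 1\<close> by (auto simp: U_def)
      then show ?thesis
        by (simp add: outer_mult sgn_scaleR sgn_div_norm[of y])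
    qed
    then show "e *\<^sub>R sgn (outer y *v a) = y" if "y \<in> U e" for y
      using that .
    show "continuous_on (U e) outer"
      by (rule continuous_on_outer)
    show "continuous_on T (\<lambda>K. e *\<^sub>R sgn (K *v a))"
      by (intro continuous_intros continuous_on_matrix_vector_left) (auto simp: T_def)
    show "outer ` U e \<subseteq> T"
      using outer_T by (auto simp: U_def)
    have rep: "\<exists>y\<in>U e. K = outer y" if K: "K \<in> T" for K
    proof -
      obtain y where y: "y \<in> sphere 0 1" "K = outer y"
        using K unfolding T_def by blast
      then have "y \<bullet> a \<noteq> 0"
        using outer_T K by simp
      then have "y \<in> U e \<or> - y \<in> U e"
        using y(1) \<open>e = 1 \<or> e = - 1\<close> by (auto simp: U_def)
      then show ?thesis
        using y(2) outer_minus by metis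
    qed
    show "(\<lambda>K. e *\<^sub>R sgn (K *v a)) ` T \<subseteq> U e"
      using rep q by fastforce
    show "outer (e *\<^sub>R sgn (K *v a)) = K" if "K \<in> T" for K
      using rep[OF that] q by fastforce
  qed
  show "\<exists>T. M \<in> T \<and> openin (top_of_set (outer ` sphere 0 1)) T \<and>
      (\<exists>v. \<Union> v = sphere 0 1 \<inter> outer -` T \<and> (\<forall>u\<in>v. openin (top_of_set (sphere 0 1)) u) \<and>
        pairwise disjnt v \<and> (\<forall>u\<in>v. \<exists>q. homeomorphism u T outer q))"
  proof (rule exI[of _ T], intro conjI)
    show "M \<in> T"
      using a outer_T[of a] by (auto simp: dot_square_norm)
    show "openin (top_of_set (outer ` sphere 0 1)) T"
      unfolding T_def
      by (intro openin_open_Int open_Collect_less continuous_intros continuous_on_matrix_vector_left)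
    have op: "openin (top_of_set (sphere 0 1)) (U e)" for e
      unfolding U_def by (intro openin_open_Int open_Collect_less continuous_intros)
    have "\<Union> {U 1, U (- 1)} = sphere 0 1 \<inter> outer -` T"
      using outer_T by (auto simp: U_def)
    moreover have "pairwise disjnt {U 1, U (- 1)}"
      by (auto simp: pairwise_insert disjnt_def U_def)
    ultimately show "\<exists>v. \<Union> v = sphere 0 1 \<inter> outer -` T \<and>
        (\<forall>u\<in>v. openin (top_of_set (sphere 0 1)) u) \<and>
        pairwise disjnt v \<and> (\<forall>u\<in>v. \<exists>q. homeomorphism u T outer q)"
      using op hom by (intro exI[of _ "{U 1, U (- 1)}"]) blast
  qed
qed (auto intro: continuous_on_outer)

definition rp2_matrix :: "rp2 \<Rightarrow> real ^ 3 ^ 3" where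
  "rp2_matrix P = outer (rep_rp2 P)"

lemma rp2_matrix_abs_rp2: "x \<in> sphere 0 1 \<Longrightarrow> rp2_matrix (abs_rp2 x) = outer x"
  using rep_rp2_abs_rp2[of x] outer_minus by (auto simp: rp2_matrix_def)

lemma continuous_on_rp2_matrix: "continuous_on UNIV rp2_matrix"
proof -
  have "continuous_on (sphere 0 1) (rp2_matrix \<circ> abs_rp2)"
    using continuous_on_outer by (rule continuous_on_eq) (simp add: rp2_matrix_abs_rp2)
  then have "continuous_map euclidean euclidean rp2_matrix"
    by (intro continuous_compose_quotient_map[OF quotient_map_abs_rp2]) simp
  then show ?thesis
    by simp
qed

lemma sign_constant:
  fixes f :: "real \<Rightarrow> real"
  assumes "continuous_on {0..1} f" "\<And>t. t \<in> {0..1} \<Longrightarrow> f t = 1 \<or> f t = - 1"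
  shows "f 0 = f 1"
proof -
  have "connected (f ` {0..1})"
    using assms(1) by (intro connected_continuous_image) auto
  moreover have "f ` {0..1} \<subseteq> {1, - 1}"
    using assms(2) by blast
  then have "finite (f ` {0..1})"
    by (rule finite_subset) simp
  ultimately obtain c where "f ` {0..1} = {c}"
    using connected_finite_iff_sing[of "f ` {0..1}"] by (metis empty_iff image_is_empty atLeastatMost_empty_iff2 zero_le_one)
  then have "f 0 \<in> {c}" "f 1 \<in> {c}"
    by force+
  then show ?thesis
    by simp
qed

text \<open>Lift a contraction \<open>h\<close> of the loop to a map \<open>l\<close> from the unit square to the sphere. The ends of
  the loops \<open>h (s, _)\<close> agree in the projective plane, so their lifts agree up to a sign, which is
  constant in \<open>s\<close> and is \<open>1\<close> at the constant loop. Thus \<open>l\<close> closes up along the original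
  loop. But \<open>l\<close> differs from \<open>sgn \<circ> k\<close> only by a sign, constant in turn, and \<open>k\<close> does not close
  up. Signs are expressed as inner products of unit vectors.\<close>
lemma noncontractible_loop_of_antipodal_lift:
  assumes k: "path k" "0 \<notin> path_image k" and antipodal: "pathfinish k = - pathstart k"
  shows "noncontractible_loop (proj \<circ> k)"
  unfolding noncontractible_loop_def
proof (intro conjI notI)
  have k0: "k t \<noteq> 0" if "t \<in> {0..1}" for t
    using k(2) that by (auto simp: path_image_def)
  show "path (proj \<circ> k)"
    using k by (intro path_continuous_image continuous_on_subset[OF continuous_on_proj]) auto
  show "pathfinish (proj \<circ> k) = pathstart (proj \<circ> k)"
    by (simp add: pathfinish_compose pathstart_compose antipodal proj_minus)
  assume "\<exists>c. homotopic_loops UNIV (proj \<circ> k) (\<lambda>_. c)"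
  then obtain c where "homotopic_loops UNIV (proj \<circ> k) (\<lambda>_. c)" ..
  then obtain h :: "real \<times> real \<Rightarrow> rp2" where h: "continuous_on ({0..1} \<times> {0..1}) h"
      "\<forall>t\<in>{0..1}. h (0, t) = proj (k t)" "\<forall>t\<in>{0..1}. h (1, t) = c"
      "\<forall>s\<in>{0..1}. h (s, 1) = h (s, 0)"
    unfolding homotopic_loops by (auto simp: pathfinish_def pathstart_def)
  let ?Q = "{0..1::real} \<times> {0..1::real}"
  have "convex ?Q"
    by (intro convex_Times) auto
  then have Q: "simply_connected ?Q" "locally path_connected ?Q"
    by (rule convex_imp_simply_connected, rule convex_imp_locally_path_connected)
  have "continuous_on ?Q (rp2_matrix \<circ> h)"
    using h(1) continuous_on_rp2_matrix by (meson continuous_on_compose continuous_on_subset subset_UNIV)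
  moreover have "rp2_matrix \<circ> h \<in> ?Q \<rightarrow> outer ` sphere 0 1"
    using rep_rp2_in_sphere by (auto simp: rp2_matrix_def)
  ultimately obtain l where l: "continuous_on ?Q l" "l \<in> ?Q \<rightarrow> sphere 0 1"
      "\<And>y. y \<in> ?Q \<Longrightarrow> outer (l y) = (rp2_matrix \<circ> h) y"
    using covering_space_lift[OF covering_space_outer Q] by blast
  have cont: "continuous_on {0..1} (\<lambda>t. l (f t))" if "continuous_on {0..1} f" "f ` {0..1} \<subseteq> ?Q"
    for f :: "real \<Rightarrow> real \<times> real"
    using that continuous_on_compose2[OF l(1)] by blast
  have sphere: "l y \<in> sphere 0 1" if "y \<in> ?Q" for y
    using l(2) that by blast
  have eq: "l y \<bullet> l z = 1 \<or> l y \<bullet> l z = - 1" if "y \<in> ?Q" "z \<in> ?Q" "h y = h z" for y z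
    using that l(3) sphere by (intro outer_eq_inner) auto
  have "l (1, 0) \<bullet> l (1, 0) = l (1, 1) \<bullet> l (1, 0)"
  proof (rule sign_constant[of "\<lambda>t. l (1, t) \<bullet> l (1, 0)"])
    show "continuous_on {0..1} (\<lambda>t. l (1, t) \<bullet> l (1, 0))"
      by (intro continuous_on_inner continuous_on_const cont continuous_on_Pair continuous_on_id) auto
    show "l (1, t) \<bullet> l (1, 0) = 1 \<or> l (1, t) \<bullet> l (1, 0) = - 1" if "t \<in> {0..1}" for t
      using that h(3) by (intro eq) auto
  qed
  moreover have "l (0, 1) \<bullet> l (0, 0) = l (1, 1) \<bullet> l (1, 0)"
  proof (rule sign_constant[of "\<lambda>s. l (s, 1) \<bullet> l (s, 0)"])
    show "continuous_on {0..1} (\<lambda>s. l (s, 1) \<bullet> l (s, 0))"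
      by (intro continuous_on_inner continuous_on_const cont continuous_on_Pair continuous_on_id) auto
    show "l (s, 1) \<bullet> l (s, 0) = 1 \<or> l (s, 1) \<bullet> l (s, 0) = - 1" if "s \<in> {0..1}" for s
      using that h(4) by (intro eq) auto
  qed
  moreover have "l (1, 0) \<bullet> l (1, 0) = 1"
    using sphere[of "(1, 0)"] by (simp add: dot_square_norm)
  ultimately have "l (0, 1) \<bullet> l (0, 0) = 1"
    by linarith
  moreover have "l (0, 0) \<bullet> l (0, 0) = 1" "l (0, 1) \<bullet> l (0, 1) = 1"
    using sphere[of "(0, 0)"] sphere[of "(0, 1)"] by (simp_all add: dot_square_norm)
  ultimately have "(norm (l (0, 1) - l (0, 0)))\<^sup>2 = 0"
    by (simp add: power2_norm_eq_inner inner_diff_left inner_diff_right inner_commute)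
  then have closed: "l (0, 1) = l (0, 0)"
    by simp
  have lk: "l (0, t) \<bullet> sgn (k t) = 1 \<or> l (0, t) \<bullet> sgn (k t) = - 1" if t: "t \<in> {0..1}" for t
  proof (rule outer_eq_inner)
    show "l (0, t) \<in> sphere 0 1"
      using sphere t by auto
    show "outer (l (0, t)) = outer (sgn (k t))"
      using l(3)[of "(0, t)"] t h(2) k0[OF t]
      by (simp add: proj_def rp2_matrix_abs_rp2 norm_sgn)
  qed
  have "l (0, 0) \<bullet> sgn (k 0) = l (0, 1) \<bullet> sgn (k 1)"
  proof (rule sign_constant[of "\<lambda>t. l (0, t) \<bullet> sgn (k t)"])
    have "continuous_on {0..1} (\<lambda>t. l (0, t))"
      by (intro cont continuous_on_Pair continuous_on_const continuous_on_id) auto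
    moreover have "continuous_on {0..1} (\<lambda>t. sgn (k t))"
      using k0 k(1) by (intro continuous_on_sgn) (auto simp: path_def)
    ultimately show "continuous_on {0..1} (\<lambda>t. l (0, t) \<bullet> sgn (k t))"
      by (rule continuous_on_inner)
  qed (rule lk)
  also have "\<dots> = - (l (0, 0) \<bullet> sgn (k 0))"
    using antipodal closed by (simp add: pathfinish_def pathstart_def sgn_minus)
  finally show False
    using lk[of 0] by simp
qed


section \<open>Geodesic arcs in the projective plane\<close>

lemma linepath_in_ray_cone:
  fixes u v :: "'a::real_inner"
  assumes "0 < u \<bullet> v" "t \<in> {0..1}"
  shows "linepath u v t \<in> ray_cone u v"
proof -
  have "0 < v \<bullet> v"
    using assms(1) by auto
  have "0 < (1 - t) * (u \<bullet> v) + t * (v \<bullet> v)"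
  proof (cases "t = 0")
    case False
    then show ?thesis
      using assms \<open>0 < v \<bullet> v\<close> by (intro add_nonneg_pos mult_nonneg_nonneg mult_pos_pos) auto
  qed (use assms in simp)
  then have "linepath u v t \<bullet> v \<noteq> 0"
    by (simp add: linepath_def inner_add_left)
  then have "linepath u v t \<noteq> 0"
    by auto
  then show ?thesis
    using assms(2) unfolding linepath_def by (intro ray_coneI) auto
qed

lemma zero_notin_ray_cone: "0 \<notin> ray_cone u v"
  by (auto simp: ray_cone_def)

lemma path_image_proj_linepath:
  fixes u v :: "real ^ 3"
  assumes "0 < u \<bullet> v"
  shows "path_image (proj \<circ> linepath u v) = proj ` ray_cone u v"
proof
  show "path_image (proj \<circ> linepath u v) \<subseteq> proj ` ray_cone u v"
    using linepath_in_ray_cone[OF assms] by (auto simp: path_image_def)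
  show "proj ` ray_cone u v \<subseteq> path_image (proj \<circ> linepath u v)"
  proof
    fix P
    assume "P \<in> proj ` ray_cone u v"
    then obtain s t where st: "P = proj (s *\<^sub>R u + t *\<^sub>R v)" "0 \<le> s" "0 \<le> t"
        "s *\<^sub>R u + t *\<^sub>R v \<noteq> 0"
      by (auto elim: ray_coneE)
    have pos: "0 < s + t"
      using st by (cases "s = 0") auto
    then have "1 - t / (s + t) = s / (s + t)"
      by (simp add: field_simps)
    then have "s *\<^sub>R u + t *\<^sub>R v = (s + t) *\<^sub>R linepath u v (t / (s + t))"
      using pos by (simp add: linepath_def scaleR_add_right)
    then have "P = proj (linepath u v (t / (s + t)))"
      using st pos by (simp add: proj_scale)
    moreover have "t / (s + t) \<in> {0..1}"
      using st pos by simp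
    ultimately show "P \<in> path_image (proj \<circ> linepath u v)"
      by (auto simp: path_image_def)
  qed
qed

text \<open>Two vectors of equal length with positive inner product that are different are
  linearly independent, so that distinct points of the segment span distinct lines.\<close>
lemma arc_proj_linepath:
  fixes u v :: "real ^ 3"
  assumes uv: "0 < u \<bullet> v" "norm u = norm v" "u \<noteq> v"
  shows "arc (proj \<circ> linepath u v)"
  unfolding arc_def
proof
  have nz: "linepath u v t \<noteq> 0" if "t \<in> {0..1}" for t
    using linepath_in_ray_cone[OF uv(1) that] zero_notin_ray_cone by metis
  then show "path (proj \<circ> linepath u v)"
    by (intro path_continuous_image continuous_on_subset[OF continuous_on_proj] path_linepath)
      (auto simp: path_image_def simp del: linepath_image_01 path_image_linepath)
  \<comment> \<open>Linear independence, in the form in which it is used: comparing lengths gives \<open>\<beta> = \<alpha>\<close> or \<open>\<beta> = - \<alpha>\<close>.\<close>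
  have indep: "\<alpha> = 0" if "\<alpha> *\<^sub>R u = \<beta> *\<^sub>R v" for \<alpha> \<beta>
  proof (rule ccontr)
    assume "\<alpha> \<noteq> 0"
    have "u \<noteq> 0"
      using uv by auto
    moreover have "\<bar>\<alpha>\<bar> * norm u = \<bar>\<beta>\<bar> * norm u"
      using that uv(2) by (metis norm_scaleR)
    ultimately have "\<beta> = \<alpha> \<or> \<beta> = - \<alpha>"
      by auto
    then have "\<alpha> *\<^sub>R u = \<alpha> *\<^sub>R v \<or> \<alpha> *\<^sub>R u = \<alpha> *\<^sub>R (- v)"
      using that by auto
    then have "u = v \<or> u = - v"
      using \<open>\<alpha> \<noteq> 0\<close> by (simp only: scaleR_cancel_left) simp
    then show False
      using uv inner_ge_zero[of v] by auto
  qed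
  show "inj_on (proj \<circ> linepath u v) {0..1}"
  proof (rule inj_onI)
    fix s t :: real
    assume st: "s \<in> {0..1}" "t \<in> {0..1}" "(proj \<circ> linepath u v) s = (proj \<circ> linepath u v) t"
    then obtain c where c: "linepath u v t = c *\<^sub>R linepath u v s"
      using proj_eqE[OF nz[OF st(1)] nz[OF st(2)]] by auto
    then have eq: "((1 - t) - c * (1 - s)) *\<^sub>R u = (c * s - t) *\<^sub>R v"
      by (simp add: linepath_def algebra_simps)
    then have u0: "(1 - t) - c * (1 - s) = 0"
      by (rule indep)
    have "v \<noteq> 0"
      using uv by auto
    with eq have "c * s = t"
      by (simp add: u0)
    moreover from this u0 have "c = 1"
      by (simp add: algebra_simps)
    ultimately show "s = t"
      by simp
  qed
qed

lemma arc_interior: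
  assumes "arc g"
  shows "g ` {0<..<1} \<subseteq> path_image g - {pathstart g, pathfinish g}"
proof -
  have inj: "inj_on g {0..1}"
    using assms by (simp add: arc_def)
  have "g t \<in> path_image g" "g t \<noteq> g 0" "g t \<noteq> g 1" if "t \<in> {0<..<1}" for t
    using that inj_onD[OF inj, of t 0] inj_onD[OF inj, of t 1] by (auto simp: path_image_def)
  then show ?thesis
    by (auto simp: pathstart_def pathfinish_def)
qed

lemma exists_generic_points:
  assumes "finite I" "finite F" "(0 :: real ^ 3) \<notin> F"
  shows "\<exists>q. (\<forall>i\<in>I. q i \<noteq> 0 \<and> (\<forall>n\<in>F. n \<bullet> q i \<noteq> 0)) \<and> inj_on (proj \<circ> q) I"
  using assms(1)
proof (induction I rule: finite_induct)
  case empty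
  then show ?case by simp
next
  case (insert i I)
  then obtain q where q: "\<And>j. j \<in> I \<Longrightarrow> q j \<noteq> 0" "\<And>j n. j \<in> I \<Longrightarrow> n \<in> F \<Longrightarrow> n \<bullet> q j \<noteq> 0"
      "inj_on (proj \<circ> q) I"
    by blast
  have "\<forall>j. \<exists>n. n \<noteq> 0 \<and> n \<bullet> q j = 0"
    by (metis exists_normal)
  then obtain m where m: "\<And>j. m j \<noteq> 0" "\<And>j. m j \<bullet> q j = 0"
    by metis
  have "m i \<in> - {0}"
    using m(1) by simp
  then have "- {0} \<noteq> ({} :: (real ^ 3) set)"
    by blast
  moreover have "0 \<notin> m ` I"
    using m(1) by (metis imageE)
  then have "finite (F \<union> m ` I)" "0 \<notin> F \<union> m ` I"
    using assms insert.hyps by simp_all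
  ultimately obtain v where v: "v \<in> - {0}" "\<And>n. n \<in> F \<union> m ` I \<Longrightarrow> n \<bullet> v \<noteq> 0"
    using exists_off_hyperplanes[of "- {0}" "F \<union> m ` I"] by blast
  have new: "proj v \<noteq> proj (q j)" if j: "j \<in> I" for j
  proof
    assume "proj v = proj (q j)"
    then obtain c where "c \<noteq> 0" "q j = c *\<^sub>R v"
      using proj_eqE[of v "q j"] v(1) q(1)[OF j] by auto
    then show False
      using m(2)[of j] v(2)[of "m j"] j by auto
  qed
  then show ?case
    using q v insert.hyps new new[symmetric]
    by (intro exI[of _ "q(i := v)"]) (auto simp: inj_on_def)
qed


section \<open>The drawing\<close>

context extended_diameter_set
begin

definition \<rho> :: "real ^ 3 \<Rightarrow> real ^ 3" where
  "\<rho> x = p x - x"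

text \<open>If \<open>a = p x\<close>, this is the single point that represents the vertex \<open>x\<close>.\<close>
definition half_edge :: "real ^ 3 \<Rightarrow> real ^ 3 \<Rightarrow> rp2 set" where
  "half_edge x a = proj ` ray_cone (\<rho> x) (a - x)"

lemma norm_\<rho>: "x \<in> S \<Longrightarrow> a \<in> nbrs x \<Longrightarrow> norm (\<rho> x) = D"
  using p_dist[of x] by (auto simp: \<rho>_def dist_norm)

text \<open>All directions of half edges at \<open>x\<close> point into the open half space towards \<open>y\<close>. This fixes the
  sign whenever two vectors are only known to span the same line.\<close>
lemma cone_inner_pos:
  assumes "x \<in> S" "a \<in> nbrs x" "y \<in> S" "y \<noteq> x" "v \<in> ray_cone (\<rho> x) (a - x)"
  shows "0 < v \<bullet> (y - x)"
proof (rule ray_cone_inner_pos[OF assms(5)])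
  have "nbrs x \<noteq> {}" "dist a x = D" "a \<in> S"
    using assms by (auto simp: nbrs_def)
  then have "(norm (y - x))\<^sup>2 / 2 \<le> \<rho> x \<bullet> (y - x)" "(norm (y - x))\<^sup>2 / 2 \<le> (a - x) \<bullet> (y - x)"
    unfolding \<rho>_def using assms p_dist[of x] p_near[of x y] dist_le[of a y]
    by (simp_all only: inner_ge_of_dist_le simp_thms)
  moreover have "0 < (norm (y - x))\<^sup>2 / 2"
    using assms by simp
  ultimately show "0 < \<rho> x \<bullet> (y - x)" "0 < (a - x) \<bullet> (y - x)"
    by linarith+
qed

lemma \<rho>_in_cone: "x \<in> S \<Longrightarrow> a \<in> nbrs x \<Longrightarrow> \<rho> x \<in> ray_cone (\<rho> x) (a - x)"
  using ray_coneI[of 1 0 "\<rho> x" "a - x"] norm_\<rho>[of x a] D_pos by auto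

lemma \<rho>_inner_pos: "x \<in> S \<Longrightarrow> a \<in> nbrs x \<Longrightarrow> 0 < \<rho> x \<bullet> (a - x)"
  using cone_inner_pos[OF _ _ _ _ \<rho>_in_cone] nbrs_subset nbrs_neq by blast

lemma normal_of_neighbours:
  assumes "x \<in> S" "a \<in> nbrs x" "b \<in> nbrs x" "a \<noteq> b"
  obtains n where "n \<bullet> (a - x) = 0" "n \<bullet> (b - x) = 0" "n \<bullet> \<rho> x \<noteq> 0"
proof -
  have "off_planes x (p x)"
    using p_generic[of x] assms by auto
  then show ?thesis
    using off_planesD[OF _ assms(2,3)] that unfolding \<rho>_def by blast
qed

lemma direction_in_cone_imp_eq:
  assumes x: "x \<in> S" "a \<in> nbrs x" "y \<in> nbrs x" and "0 < k" "k *\<^sub>R (y - x) \<in> ray_cone (\<rho> x) (a - x)"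
  shows "a = y"
proof (rule ccontr)
  assume "a \<noteq> y"
  then obtain n where n: "n \<bullet> (a - x) = 0" "n \<bullet> (y - x) = 0" "n \<bullet> \<rho> x \<noteq> 0"
    using normal_of_neighbours[OF x] by blast
  obtain s t where st: "k *\<^sub>R (y - x) = s *\<^sub>R \<rho> x + t *\<^sub>R (a - x)" "0 \<le> t"
    using assms(5) by (rule ray_coneE)
  have "n \<bullet> (k *\<^sub>R (y - x)) = s * (n \<bullet> \<rho> x)"
    unfolding st(1) using n by (simp add: inner_add_right)
  then have "s = 0"
    using n by simp
  with st have eq: "k *\<^sub>R (y - x) = t *\<^sub>R (a - x)"
    by simp
  then have "norm (k *\<^sub>R (y - x)) = norm (t *\<^sub>R (a - x))"
    by (rule arg_cong)
  then have "k = t"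
    using nbrs_norm[OF x(2)] nbrs_norm[OF x(3)] D_pos \<open>0 < k\<close> st(2) by simp
  then show False
    using eq \<open>0 < k\<close> \<open>a \<noteq> y\<close> by simp
qed

text \<open>Multiples \<open>v\<close> and \<open>w\<close> of each other in the two cones have a positive factor, since both have a
  positive inner product with \<open>a - x\<close>. A normal vector of \<open>a - x\<close> and \<open>b - x\<close> that is not
  orthogonal to \<open>\<rho> x\<close> compares the coefficients of \<open>\<rho> x\<close>, and lengths compare the others, which
  leaves \<open>v\<close> on the ray of \<open>\<rho> x\<close>.\<close>
lemma half_edges_same:
  assumes x: "x \<in> S" "a \<in> nbrs x" "b \<in> nbrs x" "a \<noteq> b"
  shows "half_edge x a \<inter> half_edge x b \<subseteq> {proj (\<rho> x)}"
proof
  fix P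
  assume "P \<in> half_edge x a \<inter> half_edge x b"
  then obtain v w where v: "v \<in> ray_cone (\<rho> x) (a - x)" "P = proj v"
      and w: "w \<in> ray_cone (\<rho> x) (b - x)" "P = proj w"
    by (auto simp: half_edge_def)
  have "v \<noteq> 0" "w \<noteq> 0"
    using v w zero_notin_ray_cone by metis+
  then obtain c where c: "c \<noteq> 0" "w = c *\<^sub>R v"
    using proj_eqE v w by metis
  have "a \<in> S" "a \<noteq> x"
    using x nbrs_subset nbrs_neq by auto
  then have "0 < v \<bullet> (a - x)" "0 < w \<bullet> (a - x)"
    using cone_inner_pos x v w by blast+
  then have "0 < c"
    using c by (simp add: zero_less_mult_iff)
  obtain n where n: "n \<bullet> (a - x) = 0" "n \<bullet> (b - x) = 0" "n \<bullet> \<rho> x \<noteq> 0"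
    using x by (rule normal_of_neighbours)
  obtain s t where st: "v = s *\<^sub>R \<rho> x + t *\<^sub>R (a - x)" "0 \<le> s" "0 \<le> t"
    using v(1) by (rule ray_coneE)
  obtain s' t' where st': "w = s' *\<^sub>R \<rho> x + t' *\<^sub>R (b - x)" "0 \<le> s'" "0 \<le> t'"
    using w(1) by (rule ray_coneE)
  have "n \<bullet> w = s' * (n \<bullet> \<rho> x)" "n \<bullet> v = s * (n \<bullet> \<rho> x)"
    using n by (simp_all add: st st' inner_add_right)
  then have "s' = c * s"
    using c n by simp
  then have eq: "t' *\<^sub>R (b - x) = (c * t) *\<^sub>R (a - x)"
    using c(2) unfolding st(1) st'(1) by (simp add: scaleR_add_right)
  then have "norm (t' *\<^sub>R (b - x)) = norm ((c * t) *\<^sub>R (a - x))"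
    by (rule arg_cong)
  then have "t' = c * t"
    using nbrs_norm[OF x(2)] nbrs_norm[OF x(3)] D_pos \<open>0 < c\<close> st st' by simp
  then have "t = 0"
    using eq \<open>a \<noteq> b\<close> \<open>0 < c\<close> by auto
  then have "v = s *\<^sub>R \<rho> x" "s \<noteq> 0"
    using st \<open>v \<noteq> 0\<close> by auto
  then show "P \<in> {proj (\<rho> x)}"
    using v(2) by (simp add: proj_scale)
qed

text \<open>By \<open>cone_inner_pos\<close> the representatives of \<open>P\<close> in the two cones point in opposite directions, so
  that \<open>antipodal_cones_meet\<close> makes \<open>xy\<close> an edge and \<open>P\<close> its midpoint. Genericity of \<open>\<rho> x\<close>
  and \<open>\<rho> y\<close> excludes half edges of other edges from that midpoint.\<close>
lemma half_edges_other:
  assumes x: "x \<in> S" "a \<in> nbrs x" and y: "y \<in> S" "b \<in> nbrs y" and "x \<noteq> y"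
    and P: "P \<in> half_edge x a" "P \<in> half_edge y b"
  shows "a = y \<and> b = x \<and> P = proj (y - x)"
proof -
  obtain v w where v: "v \<in> ray_cone (\<rho> x) (a - x)" "P = proj v"
      and w: "w \<in> ray_cone (\<rho> y) (b - y)" "P = proj w"
    using P by (auto simp: half_edge_def)
  have "v \<noteq> 0" "w \<noteq> 0"
    using v w zero_notin_ray_cone by metis+
  then obtain c where c: "c \<noteq> 0" "w = c *\<^sub>R v"
    using proj_eqE v w by metis
  have "0 < v \<bullet> (y - x)"
    using cone_inner_pos[OF x y(1) _ v(1)] \<open>x \<noteq> y\<close> by simp
  moreover have "0 < w \<bullet> (x - y)"
    using cone_inner_pos[OF y x(1) _ w(1)] \<open>x \<noteq> y\<close> by simp
  then have "0 < (- c) * (v \<bullet> (y - x))"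
    using c by (simp add: inner_diff_right algebra_simps)
  ultimately have "0 < - c"
    by (simp add: mult_less_0_iff)
  have ne: "nbrs x \<noteq> {}" "nbrs y \<noteq> {}"
    using x y by auto
  have aS: "a \<in> S" "b \<in> S" "dist a x = D" "dist b y = D"
    using x y by (auto simp: nbrs_def)
  have "dist x y = D \<and> (\<exists>k>0. v = k *\<^sub>R (y - x))"
  proof (rule antipodal_cones_meet)
    show "v \<in> ray_cone (p x - x) (a - x)" "- ((- c) *\<^sub>R v) \<in> ray_cone (p y - y) (b - y)"
      using v(1) w(1) c by (simp_all add: \<rho>_def)
    show "dist x (p y) \<le> D" "dist (p x) b \<le> D" "dist a (p y) \<le> D"
      using p_near[OF x(1) ne(1)] p_near[OF y(1) ne(2)] x(1) aS by (simp_all add: dist_commute)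
  qed (use D_pos x(1) y(1) aS ne p_dist p_near p_near_p dist_le \<open>0 < - c\<close> in simp_all)
  then obtain k where k: "dist x y = D" "0 < k" "v = k *\<^sub>R (y - x)"
    by blast
  then have adj: "y \<in> nbrs x" "x \<in> nbrs y"
    using x(1) y(1) by (auto simp: nbrs_def dist_commute)
  have "w = (- c * k) *\<^sub>R (x - y)"
    using c k by (simp add: scaleR_diff_right)
  then have "b = x"
    using direction_in_cone_imp_eq[OF y adj(2), of "- c * k"] w(1) k(2) \<open>0 < - c\<close>
    by (simp add: mult_neg_pos)
  moreover have "a = y"
    using direction_in_cone_imp_eq[OF x adj(1) k(2)] v(1) k(3) by simp
  moreover have "P = proj (y - x)"
    using v(2) k by (simp add: proj_scale)
  ultimately show ?thesis
    by simp
qed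

definition half_path :: "real ^ 3 \<Rightarrow> real ^ 3 \<Rightarrow> real \<Rightarrow> real ^ 3" where
  "half_path x a = linepath (\<rho> x) (a - x)"

text \<open>A lift of the edge, running from \<open>\<rho> x\<close> through \<open>y - x\<close> to \<open>- \<rho> y\<close>. A half that is collapsed to a
  point is left out, because a curve that rests is not an arc.\<close>
definition edge_path :: "real ^ 3 \<Rightarrow> real ^ 3 \<Rightarrow> real \<Rightarrow> real ^ 3" where
  "edge_path x y =
    (if \<rho> x = y - x then uminus \<circ> reversepath (half_path y x)
     else if \<rho> y = x - y then half_path x y
     else half_path x y +++ (uminus \<circ> reversepath (half_path y x)))"

lemma half_path_ends [simp]:
  "pathstart (half_path x a) = \<rho> x" "pathfinish (half_path x a) = a - x"
  by (simp_all add: half_path_def)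

lemma \<rho>_asym: "x \<in> S \<Longrightarrow> y \<in> nbrs x \<Longrightarrow> \<rho> x = y - x \<Longrightarrow> \<rho> y \<noteq> x - y"
  using p_asym[of x y] by (auto simp: \<rho>_def)

lemma edge_path_reverse:
  assumes "x \<in> S" "y \<in> nbrs x"
  shows "edge_path y x = uminus \<circ> reversepath (edge_path x y)"
proof -
  have 1: "uminus \<circ> reversepath (uminus \<circ> reversepath g) = g" for g :: "real \<Rightarrow> real ^ 3"
    by (simp add: reversepath_def fun_eq_iff)
  have "uminus \<circ> reversepath (half_path x y +++ (uminus \<circ> reversepath (half_path y x))) =
      half_path y x +++ (uminus \<circ> reversepath (half_path x y))"
    by (subst reversepath_joinpaths)
      (simp_all add: pathstart_compose pathfinish_compose path_compose_join 1)
  then show ?thesis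
    using \<rho>_asym[OF assms] by (auto simp: edge_path_def 1)
qed

lemma edge_path_ends:
  assumes "x \<in> S" "y \<in> nbrs x"
  shows "pathstart (edge_path x y) = \<rho> x" "pathfinish (edge_path x y) = - \<rho> y"
  by (auto simp: edge_path_def pathstart_compose pathfinish_compose)

lemma half_path_nonzero:
  assumes "x \<in> S" "a \<in> nbrs x"
  shows "0 \<notin> path_image (half_path x a)"
  unfolding half_path_def path_image_def
  using linepath_in_ray_cone[OF \<rho>_inner_pos[OF assms]] zero_notin_ray_cone
  by (metis (no_types, lifting) image_iff)

lemma edge_path_path:
  assumes "x \<in> S" "y \<in> nbrs x"
  shows "path (edge_path x y)" "0 \<notin> path_image (edge_path x y)"
proof -
  have y: "y \<in> S" "x \<in> nbrs y"
    using nbrs_sym[OF assms] nbrs_subset[OF assms(2)] by auto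
  have 1: "path (half_path x y)" "path (uminus \<circ> reversepath (half_path y x))"
    by (auto simp: half_path_def intro!: path_continuous_image continuous_intros)
  then show "path (edge_path x y)"
    by (auto simp: edge_path_def pathstart_compose intro!: path_join_imp)
  have 2: "0 \<notin> path_image (half_path x y)"
      "0 \<notin> path_image (uminus \<circ> reversepath (half_path y x))"
    using half_path_nonzero[OF assms] half_path_nonzero[OF y]
    by (simp_all only: path_image_compose path_image_reversepath) auto
  then show "0 \<notin> path_image (edge_path x y)"
    using path_image_join_subset[of "half_path x y" "uminus \<circ> reversepath (half_path y x)"]
    by (auto simp: edge_path_def)
qed

definition edge_curve :: "(real ^ 3) \<times> (real ^ 3) \<Rightarrow> real \<Rightarrow> rp2" where
  "edge_curve = (\<lambda>(x, y). proj \<circ> edge_path x y)"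

lemma proj_uminus_comp: "proj \<circ> (uminus \<circ> g) = proj \<circ> g"
  by (simp add: fun_eq_iff proj_minus)

lemma edge_curve_reverse: "x \<in> S \<Longrightarrow> y \<in> nbrs x \<Longrightarrow> edge_curve (y, x) = reversepath (edge_curve (x, y))"
  by (simp add: edge_curve_def edge_path_reverse proj_uminus_comp path_compose_reversepath)

lemma edge_curve_ends:
  assumes "x \<in> S" "y \<in> nbrs x"
  shows "pathstart (edge_curve (x, y)) = proj (\<rho> x)" "pathfinish (edge_curve (x, y)) = proj (\<rho> y)"
  using edge_path_ends[OF assms]
  by (simp_all add: edge_curve_def pathstart_compose pathfinish_compose proj_minus)

lemma half_path_image_arc:
  assumes "x \<in> S" "a \<in> nbrs x"
  shows "path_image (proj \<circ> half_path x a) = half_edge x a"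
    and "\<rho> x \<noteq> a - x \<Longrightarrow> arc (proj \<circ> half_path x a)"
  unfolding half_path_def half_edge_def
  using \<rho>_inner_pos[OF assms] norm_\<rho>[OF assms] nbrs_norm[OF assms(2)]
  by (auto intro!: path_image_proj_linepath arc_proj_linepath)

lemma edge_curve_arc:
  assumes "x \<in> S" "y \<in> nbrs x"
  shows "arc (edge_curve (x, y))" "path_image (edge_curve (x, y)) \<subseteq> half_edge x y \<union> half_edge y x"
proof -
  have y: "y \<in> S" "x \<in> nbrs y" and "x \<noteq> y"
    using nbrs_sym[OF assms] nbrs_subset[OF assms(2)] nbrs_neq[OF assms(2)] by auto
  let ?g = "proj \<circ> half_path x y" and ?h = "reversepath (proj \<circ> half_path y x)"
  have edge_curve: "edge_curve (x, y) = (if \<rho> x = y - x then ?h else if \<rho> y = x - y then ?g else ?g +++ ?h)"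
    by (simp add: edge_curve_def edge_path_def proj_uminus_comp path_compose_join path_compose_reversepath)
  have ends: "pathfinish ?g = pathstart ?h" "pathstart ?h = proj (y - x)"
    using proj_minus[of "y - x"] by (simp_all add: pathfinish_compose)
  have img: "path_image ?g = half_edge x y" "path_image ?h = half_edge y x"
    using half_path_image_arc(1)[OF assms] half_path_image_arc(1)[OF y] by simp_all
  have meet: "path_image ?g \<inter> path_image ?h \<subseteq> {pathstart ?h}"
    using half_edges_other[OF assms y \<open>x \<noteq> y\<close>] unfolding img ends by blast
  have arcs: "\<rho> x \<noteq> y - x \<Longrightarrow> arc ?g" "\<rho> y \<noteq> x - y \<Longrightarrow> arc ?h"
    using half_path_image_arc(2)[OF assms] half_path_image_arc(2)[OF y] by (auto intro: arc_reversepath)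
  show "arc (edge_curve (x, y))"
    using arcs \<rho>_asym[OF assms] arc_join[OF arcs ends(1) meet] unfolding edge_curve by auto
  show "path_image (edge_curve (x, y)) \<subseteq> half_edge x y \<union> half_edge y x"
    using path_image_join_subset[of ?g ?h] img unfolding edge_curve by auto
qed

lemma edge_curve_interior:
  assumes "x \<in> S" "y \<in> nbrs x"
  shows "edge_curve (x, y) ` {0<..<1} \<subseteq> half_edge x y \<union> half_edge y x - {proj (\<rho> x), proj (\<rho> y)}"
  using arc_interior[OF edge_curve_arc(1)[OF assms]] edge_curve_arc(2)[OF assms] edge_curve_ends[OF assms] by auto

lemma \<rho>_in_half_edge: "x \<in> S \<Longrightarrow> a \<in> nbrs x \<Longrightarrow> proj (\<rho> x) \<in> half_edge x a"
  using \<rho>_in_cone by (auto simp: half_edge_def)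

text \<open>Both vectors have length \<open>D\<close> and their inner product is positive, so they cannot be opposite.\<close>
lemma proj_\<rho>_eq:
  assumes x: "x \<in> S" "a \<in> nbrs x" and "proj (\<rho> x) = proj (a - x)"
  shows "\<rho> x = a - x"
proof -
  have "\<rho> x \<noteq> 0" "a - x \<noteq> 0"
    using norm_\<rho>[OF x] nbrs_norm[OF x(2)] D_pos by auto
  then obtain c where c: "a - x = c *\<^sub>R \<rho> x"
    using proj_eqE assms(3) by metis
  then have "norm (a - x) = norm (c *\<^sub>R \<rho> x)"
    by (rule arg_cong)
  then have "\<bar>c\<bar> = 1"
    using norm_\<rho>[OF x] nbrs_norm[OF x(2)] D_pos by simp
  moreover have "0 < c"
    using \<rho>_inner_pos[OF x] \<open>\<rho> x \<noteq> 0\<close> zero_less_mult_pos2[of c "\<rho> x \<bullet> \<rho> x"] by (simp add: c)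
  ultimately show ?thesis
    using c by simp
qed

text \<open>Otherwise the point is the midpoint of the edge \<open>xy\<close>, which would be collapsed from both ends.\<close>
lemma vertices_distinct:
  assumes x: "x \<in> S" "a \<in> nbrs x" and y: "y \<in> S" "b \<in> nbrs y" and eq: "proj (\<rho> x) = proj (\<rho> y)"
  shows "x = y"
proof (rule ccontr)
  assume "x \<noteq> y"
  then have "a = y \<and> b = x \<and> proj (\<rho> x) = proj (y - x)"
    using half_edges_other[OF x y] \<rho>_in_half_edge[OF x] \<rho>_in_half_edge[OF y] eq by metis
  then have "y \<in> nbrs x" "x \<in> nbrs y" "proj (\<rho> x) = proj (y - x)" "proj (\<rho> y) = proj (x - y)"
    using x y eq proj_minus[of "x - y"] by auto
  then have "\<rho> x = y - x" "\<rho> y = x - y"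
    using x(1) y(1) by (auto intro: proj_\<rho>_eq)
  then show False
    using \<rho>_asym[OF x(1) \<open>y \<in> nbrs x\<close>] by simp
qed

lemma vertex_off_edge:
  assumes x: "x \<in> S" "y \<in> nbrs x" and w: "w \<in> S" "c \<in> nbrs w"
  shows "proj (\<rho> w) \<notin> edge_curve (x, y) ` {0<..<1}"
proof
  assume "proj (\<rho> w) \<in> edge_curve (x, y) ` {0<..<1}"
  then have P: "proj (\<rho> w) \<in> half_edge x y \<union> half_edge y x"
      "proj (\<rho> w) \<noteq> proj (\<rho> x)" "proj (\<rho> w) \<noteq> proj (\<rho> y)"
    using edge_curve_interior[OF x] by auto
  have y: "y \<in> S" "x \<in> nbrs y"
    using nbrs_sym[OF x] nbrs_subset[OF x(2)] by auto
  have "w \<noteq> x" "w \<noteq> y"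
    using P by auto
  then show False
    using P(1) half_edges_other[OF x w] half_edges_other[OF y w] \<rho>_in_half_edge[OF w] by blast
qed

text \<open>Half edges of different edges meet at most in the point of a common vertex, which is
  an end of both edges.\<close>
lemma edges_disjoint:
  assumes x: "x \<in> S" "y \<in> nbrs x" and x': "x' \<in> S" "y' \<in> nbrs x'" and ne: "{x, y} \<noteq> {x', y'}"
  shows "edge_curve (x, y) ` {0<..<1} \<inter> edge_curve (x', y') ` {0<..<1} = {}"
proof -
  have disj: "half_edge u a \<inter> half_edge v b \<subseteq> {proj (\<rho> u)}"
    if "u \<in> S" "a \<in> nbrs u" "v \<in> S" "b \<in> nbrs v" "{u, a} \<noteq> {v, b}" for u a v b
  proof (cases "u = v")
    case True
    then show ?thesis
      using half_edges_same[of u a b] that by auto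
  next
    case False
    then show ?thesis
      using half_edges_other[OF that(1-4)] that(5) by blast
  qed
  have y: "y \<in> S" "x \<in> nbrs y" and y': "y' \<in> S" "x' \<in> nbrs y'"
    using nbrs_sym nbrs_subset x x' by blast+
  have "half_edge x y \<inter> half_edge x' y' \<subseteq> {proj (\<rho> x)}"
    "half_edge x y \<inter> half_edge y' x' \<subseteq> {proj (\<rho> x)}"
    "half_edge y x \<inter> half_edge x' y' \<subseteq> {proj (\<rho> y)}"
    "half_edge y x \<inter> half_edge y' x' \<subseteq> {proj (\<rho> y)}"
    using disj[OF x x'] disj[OF x y'] disj[OF y x'] disj[OF y y'] ne by (auto simp: insert_commute)
  then show ?thesis
    using edge_curve_interior[OF x] edge_curve_interior[OF x'] by blast
qed

lemma half_edge_in_plane: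
  assumes "n \<bullet> \<rho> x = 0" "n \<bullet> (y - x) = 0" "n \<bullet> q \<noteq> 0"
  shows "proj q \<notin> half_edge x y"
proof
  assume "proj q \<in> half_edge x y"
  then obtain v where v: "v \<in> ray_cone (\<rho> x) (y - x)" "proj v = proj q"
    by (auto simp: half_edge_def)
  have "v \<noteq> 0" "q \<noteq> 0"
    using v(1) zero_notin_ray_cone assms by auto
  then obtain c where "q = c *\<^sub>R v"
    using proj_eqE v(2) by metis
  moreover have "n \<bullet> v = 0"
    using v(1) assms by (auto simp: ray_cone_def inner_add_right)
  ultimately show False
    using assms by simp
qed

lemma edge_curve_graph_embedding:
  assumes G: "pverts G = S" "parcs G = {(x, y). x \<in> S \<and> y \<in> nbrs x}"
  obtains \<phi> where "graph_embedding G \<phi> edge_curve"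
proof -
  define nrm where "nrm = (\<lambda>(x, y). SOME n. n \<noteq> 0 \<and> n \<bullet> \<rho> x = 0 \<and> n \<bullet> (y - x) = 0)"
  have nrm: "nrm (x, y) \<noteq> 0 \<and> nrm (x, y) \<bullet> \<rho> x = 0 \<and> nrm (x, y) \<bullet> (y - x) = 0" for x y
    unfolding nrm_def prod.case by (rule someI_ex) (metis exists_normal)
  have "finite {x \<in> S. nbrs x = {}}" "finite (nrm ` (S \<times> S))" "0 \<notin> nrm ` (S \<times> S)"
    using finite_S nrm by auto
  then obtain q where q: "\<And>x n. x \<in> S \<Longrightarrow> nbrs x = {} \<Longrightarrow> n \<in> nrm ` (S \<times> S) \<Longrightarrow> n \<bullet> q x \<noteq> 0"
      "inj_on (proj \<circ> q) {x \<in> S. nbrs x = {}}"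
    using exists_generic_points[of "{x \<in> S. nbrs x = {}}" "nrm ` (S \<times> S)"] by blast
  have q_off: "proj (q w) \<notin> half_edge x y" if "w \<in> S" "nbrs w = {}" "x \<in> S" "y \<in> S" for w x y
    using half_edge_in_plane[of "nrm (x, y)" x y "q w"] nrm[of x y] q(1)[OF that(1,2), of "nrm (x, y)"] that
    by auto
  define \<phi> where "\<phi> x = (if nbrs x = {} then proj (q x) else proj (\<rho> x))" for x
  have off: "\<phi> w \<notin> edge_curve (x, y) ` {0<..<1}" if "x \<in> S" "y \<in> nbrs x" "w \<in> S" for x y w
  proof (cases "nbrs w = {}")
    case True
    then show ?thesis
      using q_off[OF that(3) True, of x y] q_off[OF that(3) True, of y x] edge_curve_interior[OF that(1,2)] that
        nbrs_subset[OF that(2)] by (auto simp: \<phi>_def)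
  next
    case False
    then obtain c where "c \<in> nbrs w"
      by blast
    then show ?thesis
      using vertex_off_edge[OF that] False by (simp add: \<phi>_def)
  qed
  have "inj_on \<phi> S"
  proof (rule inj_onI)
    fix x y
    assume xy: "x \<in> S" "y \<in> S" "\<phi> x = \<phi> y"
    have iso: False if uv: "u \<in> S" "v \<in> S" "nbrs u = {}" "nbrs v \<noteq> {}" "\<phi> u = \<phi> v" for u v
    proof -
      obtain a where "a \<in> nbrs v"
        using uv(4) by blast
      then show False
        using q_off[OF uv(1,3,2), of a] \<rho>_in_half_edge[OF uv(2), of a] nbrs_subset[of a v] uv
        by (simp add: \<phi>_def)
    qed
    consider "nbrs x = {}" "nbrs y = {}" | a b where "a \<in> nbrs x" "b \<in> nbrs y"
      using iso[OF xy(1,2) _ _ xy(3)] iso[OF xy(2,1) _ _ xy(3)[symmetric]] by blast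
    then show "x = y"
    proof cases
      case 1
      then show ?thesis
        using q(2) xy by (auto simp: \<phi>_def inj_on_def)
    next
      case (2 a b)
      then have "proj (\<rho> x) = proj (\<rho> y)"
        using xy(3) by (auto simp: \<phi>_def split: if_splits)
      then show ?thesis
        by (rule vertices_distinct[OF xy(1) 2(1) xy(2) 2(2)])
    qed
  qed
  moreover have "arc (edge_curve (x, y)) \<and> pathstart (edge_curve (x, y)) = \<phi> x \<and> pathfinish (edge_curve (x, y)) = \<phi> y \<and>
      edge_curve (y, x) = reversepath (edge_curve (x, y)) \<and> edge_curve (x, y) ` {0<..<1} \<inter> \<phi> ` S = {}"
    if "x \<in> S" "y \<in> nbrs x" for x y
  proof -
    have "nbrs x \<noteq> {}" "nbrs y \<noteq> {}"
      using that nbrs_sym[OF that] by auto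
    then have "\<phi> x = proj (\<rho> x)" "\<phi> y = proj (\<rho> y)"
      by (simp_all add: \<phi>_def)
    moreover have "edge_curve (x, y) ` {0<..<1} \<inter> \<phi> ` S = {}"
    proof (rule equals0I)
      fix P
      assume "P \<in> edge_curve (x, y) ` {0<..<1} \<inter> \<phi> ` S"
      then obtain w where "w \<in> S" "P = \<phi> w" "P \<in> edge_curve (x, y) ` {0<..<1}"
        by (elim IntE imageE[of _ \<phi>])
      then show False
        using off[OF that \<open>w \<in> S\<close>] by simp
    qed
    ultimately show ?thesis
      using edge_curve_arc(1)[OF that] edge_curve_ends[OF that] edge_curve_reverse[OF that] by simp
  qed
  ultimately have "graph_embedding G \<phi> edge_curve"
    unfolding graph_embedding_def G using edges_disjoint by auto
  then show ?thesis
    by (rule that)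
qed


section \<open>Odd cycles\<close>

text \<open>Each edge changes the sign, so the lifts of consecutive edges fit together after applying \<open>uminus\<close>
  to the rest of the walk.\<close>
lemma walk_lift:
  assumes "es \<noteq> []" "u \<in> S" "set es \<subseteq> {(x, y). x \<in> S \<and> y \<in> nbrs x}" "pcas u es v"
  shows "\<exists>k. path k \<and> 0 \<notin> path_image k \<and> pathstart k = \<rho> u \<and>
    pathfinish k = (- 1) ^ length es *\<^sub>R \<rho> v \<and> joinpaths_list (map edge_curve es) = proj \<circ> k"
  using assms
proof (induction es arbitrary: u rule: list_nonempty_induct)
  case (single e)
  then obtain w where e: "e = (u, w)" "w = v" "w \<in> nbrs u"
    by (cases e) auto
  then show ?case
    using edge_path_path[of u v] edge_path_ends[of u v] single
    by (intro exI[of _ "edge_path u v"]) (simp add: edge_curve_def)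
next
  case (cons e es)
  then obtain w where e: "e = (u, w)" "w \<in> nbrs u" "pcas w es v"
    by (cases e) auto
  then have "w \<in> S"
    using nbrs_subset by blast
  moreover have "set es \<subseteq> {(x, y). x \<in> S \<and> y \<in> nbrs x}"
    using cons.prems(2) by simp
  ultimately have "\<exists>k. path k \<and> 0 \<notin> path_image k \<and> pathstart k = \<rho> w \<and>
      pathfinish k = (- 1) ^ length es *\<^sub>R \<rho> v \<and> joinpaths_list (map edge_curve es) = proj \<circ> k"
    using e(3) by (rule cons.IH)
  then obtain k where k: "path k" "0 \<notin> path_image k" "pathstart k = \<rho> w"
      "pathfinish k = (- 1) ^ length es *\<^sub>R \<rho> v" "joinpaths_list (map edge_curve es) = proj \<circ> k"
    by blast
  obtain f fs where es: "es = f # fs"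
    using \<open>es \<noteq> []\<close> by (cases es) auto
  let ?k = "edge_path u w +++ (uminus \<circ> k)"
  have uw: "u \<in> S" "w \<in> nbrs u"
    using cons.prems e by auto
  have "path (uminus \<circ> k)" "0 \<notin> path_image (uminus \<circ> k)" "pathstart (uminus \<circ> k) = - \<rho> w"
    using k by (auto simp: path_image_compose pathstart_compose intro!: path_continuous_image continuous_intros)
  then have "path ?k" "0 \<notin> path_image ?k"
    using edge_path_path[OF uw] edge_path_ends[OF uw]
      path_image_join_subset[of "edge_path u w" "uminus \<circ> k"] by (auto intro!: path_join_imp)
  moreover have "pathstart ?k = \<rho> u" "pathfinish ?k = (- 1) ^ length (e # es) *\<^sub>R \<rho> v"
    using edge_path_ends[OF uw] k by (simp_all add: pathfinish_compose)
  moreover have "joinpaths_list (map edge_curve (e # es)) = edge_curve e +++ joinpaths_list (map edge_curve es)"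
    by (simp add: es)
  then have "joinpaths_list (map edge_curve (e # es)) = proj \<circ> ?k"
    by (simp only: k(5) path_compose_join proj_uminus_comp) (simp add: e(1) edge_curve_def)
  ultimately show ?case
    by blast
qed

lemma odd_closed_walk_noncontractible:
  assumes "es \<noteq> []" "odd (length es)" "u \<in> S" "set es \<subseteq> {(x, y). x \<in> S \<and> y \<in> nbrs x}" "pcas u es u"
  shows "noncontractible_loop (joinpaths_list (map edge_curve es))"
proof -
  obtain k where "path k" "0 \<notin> path_image k" "pathstart k = \<rho> u"
      "pathfinish k = (- 1) ^ length es *\<^sub>R \<rho> u" "joinpaths_list (map edge_curve es) = proj \<circ> k"
    using walk_lift[OF assms(1,3,4,5)] by blast
  then show ?thesis
    using noncontractible_loop_of_antipodal_lift[of k] assms(2) by simp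
qed

end


section \<open>The diameter graph in the projective plane\<close>

theorem corollary3:
  fixes S :: "(real ^ 3) set"
  assumes "finite S"
  shows "\<exists>(\<phi> :: real ^ 3 \<Rightarrow> rp2) (\<gamma> :: (real ^ 3) \<times> (real ^ 3) \<Rightarrow> real \<Rightarrow> rp2).
    graph_embedding (diameter_graph S) \<phi> \<gamma> \<and>
    (\<forall>p. odd_cycle (diameter_graph S) p \<longrightarrow> noncontractible_loop (joinpaths_list (map \<gamma> p)))"
proof -
  have bound: "dist x y \<le> diameter S" if "x \<in> S" "y \<in> S" for x y
    using assms that by (intro diameter_bounded_bound finite_imp_bounded)
  have cycle: "\<exists>u\<in>S. es \<noteq> [] \<and> odd (length es) \<and> set es \<subseteq> parcs (diameter_graph S) \<and> pcas u es u"
    if "odd_cycle (diameter_graph S) es" for es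
  proof -
    have "pverts (diameter_graph S) = S"
      by (simp add: diameter_graph_def)
    then show ?thesis
      using that by (auto simp: odd_cycle_def pre_digraph.cycle_def pre_digraph.awalk_def cas_with_proj_eq)
  qed
  show ?thesis
  proof (cases "0 < diameter S")
    case True
    then interpret diameter_set S "diameter S"
      by unfold_locales (use assms bound in auto)
    obtain p where "extended_diameter_set S (diameter S) p"
      by (rule extension_exists)
    then interpret extended_diameter_set S "diameter S" p .
    have arcs: "parcs (diameter_graph S) = {(x, y). x \<in> S \<and> y \<in> nbrs x}"
      using True by (auto simp: diameter_graph_def nbrs_def dist_commute)
    obtain \<phi> where "graph_embedding (diameter_graph S) \<phi> edge_curve"
      using edge_curve_graph_embedding[OF _ arcs] by (auto simp: diameter_graph_def)
    moreover have "noncontractible_loop (joinpaths_list (map edge_curve es))"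
      if "odd_cycle (diameter_graph S) es" for es
      using cycle[OF that] odd_closed_walk_noncontractible unfolding arcs by blast
    ultimately show ?thesis
      by blast
  next
    \<comment> \<open>A set with at most one point has no edges.\<close>
    case False
    have "x = y" if "x \<in> S" "y \<in> S" for x y
      using bound[OF that] False by (metis dist_le_zero_iff linorder_not_le order_trans)
    then have "parcs (diameter_graph S) = {}" "inj_on (\<lambda>_. proj 0) (pverts (diameter_graph S))"
      by (auto simp: diameter_graph_def inj_on_def)
    then show ?thesis
      using cycle by (auto simp: graph_embedding_def)
  qed
qed

end
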